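(* Let $M$ be a hyperbolic $3$-manifold with cusp ends, and let $\mathcal T$ be an ideal triangulation of $M$ that supports angle structures. Then for each $b\in(0,1)$, the integral $$\mathrm{TV}_b(M,\mathcal T)=\int_{(\frac Q2+\mathbf i\mathbb R)^E/\mathbb R^V}\prod_{e\in E}|e|_{\boldsymbol a}\prod_{\Delta\in T}|\Delta|_{\boldsymbol a}\,d\mu([\boldsymbol a])$$ converges absolutely.
   Context: Ideal $6j$ symbol. For $b\in(0,1)$ let $Q=b+\frac1b$. For $z\in\mathbb C$ let $T_b(z)=e^{-\frac{\pi\mathbf i}{2}(z^2-Qz+\frac{Q^2+1}{6})}$, with the convention $T_b(z)^{1/2}=e^{-\frac{\pi\mathbf i}{4}(z^2-Qz+\frac{Q^2+1}{6})}$ (square roots of products/quotients of $T_b$'s are the corresponding products/quotients of these square roots). For $0<\mathrm{Re}(z)<Q$ let $S_b(z)=\exp\Big(\int_\Omega\frac{\sinh((\frac Q2-z)t)}{4t\sinh(\frac{bt}2)\sinh(\frac t{2b})}dt\Big)$, where $\Omega$ goes along the real line and passes above the pole at the origin. For $(a_1,\dots,a_6)\in(\frac Q2+\mathbf i\mathbb R)^6$ let $t_1=a_1+a_2+a_3$, $t_2=a_1+a_5+a_6$, $t_3=a_2+a_4+a_6$, $t_4=a_3+a_4+a_5$, $q_1=a_1+a_2+a_4+a_5$, $q_2=a_1+a_3+a_4+a_6$, $q_3=a_2+a_3+a_5+a_6$. The ideal $\mathrm U_{q\tilde q}\mathfrak{sl}(2;\mathbb R)$-$6j$ symbol is $$\bigg|\begin{matrix}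 a_1 & a_2 & a_3 \\ a_4 & a_5 & a_6 \end{matrix} \bigg|_b=\Bigg(\frac{\prod_{i=1}^4 T_b(2Q-t_i)}{\prod_{i=1}^4\prod_{j=1}^3 T_b(q_j-t_i)}\Bigg)^{\frac12}\int_\Gamma \frac{\prod_{i=1}^4 T_b(u-t_i)}{T_b(2Q-u)}\prod_{j=1}^3S_b(q_j-u)\,d\mathrm{Im}u,$$ where $\Gamma$ is any vertical line passing through $(\frac{11Q}6,2Q)$, oriented upward (the integral does not depend on $\Gamma$). Triangulations. A hyperbolic $3$-manifold with cusp ends is a complete finite-volume hyperbolic $3$-manifold all of whose ends are cusps, identified with the interior of a compact manifold whose boundary components correspond to the cusps. An ideal triangulation $\mathcal T$ of $M$ is a finite collection of tetrahedra glued in pairs along faces so that the quotient minus vertices is homeomorphic to $M$ (equivalently, truncating vertices gives the compact manifold). $E,T,V$ are the sets of edges of $\mathcal T$, tetrahedra of $\mathcal T$, and boundary components of $M$. Angle structures. A corner $(\Delta,e)$ is an incidence of an edge $e$ with a tetrahedron $\Delta$ (counted with multiplicity). An angle structure assigns to each corner a number in $(0,\pi)$ so that in each tetrahedron the three angles at edges adjacent to each vertex sum to $\pi$, and the angles of all corners around each edge $e\in E$ sum to $2\pi$. $\mathcal T$ supports angle structures if one exists. State integral. For $\boldsymbol a=(a_e)_{e\in E}\in(\frac Q2+\mathbf i\mathbb R)^E$, $a_e=\frac Q2+\mathbf i\frac{x_e}{2\pi b}$, let $|e|_{\boldsymbol a}=|T_b(2a_e)|^2=e^{Qx_e/b}$,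 and $|\Delta|_{\boldsymbol a}=\bigg|\begin{matrix} a_{e_1} & a_{e_2} & a_{e_3} \\ a_{e_4} & a_{e_5} & a_{e_6}\end{matrix}\bigg|_b$, where $e_1,\dots,e_6$ are the edges of $\Delta$ with $e_1,e_2,e_3$ the edges of a face and $e_i,e_{i+3}$ opposite. Let $A$ be the $|E|\times|V|$ matrix with $A_{e,v}=|e\cap v|$, the number of ends of $e$ at the boundary component $v$; it is injective as a map $\mathbb R^V\to\mathbb R^E$. $\mathbb R^V$ acts on $(\frac Q2+\mathbf i\mathbb R)^E$ by $\boldsymbol u\cdot\boldsymbol a=\boldsymbol a+\frac{\mathbf i}{2\pi b}A\boldsymbol u$; the integrand is invariant. $d\mu$ is the quotient measure obtained by disintegrating the Lebesgue measure $\prod_{e}d\mathrm{Im}a_e$ along the orbits (with Lebesgue measure on $\mathbb R^V$). Concretely, if $X\subset(\frac Q2+\mathbf i\mathbb R)^E\cong\mathbb R^E$ (via $\boldsymbol a\mapsto\mathrm{Im}\,\boldsymbol a$) is the orthogonal complement of $A(\mathbb R^V)$ with induced Lebesgue measure $dm_X$, then $\mathrm{TV}_b(M,\mathcal T)=(\frac1{2\pi b})^{|V|}\sqrt{\det(A^TA)}\int_X\prod_e|e|_{\boldsymbol a}\prod_\Delta|\Delta|_{\boldsymbol a}\,dm_X(\boldsymbol a)$. *)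

theory Defs
  imports "HOL-Analysis.Analysis" "HOL-Complex_Analysis.Contour_Integration"
begin

section \<open>Hyperbolic 3-manifolds with cusp ends\<close>

text \<open>Upper half-space model of hyperbolic 3-space: points \<open>(z, t)\<close> with \<open>t > 0\<close>, metric
  \<open>(|dz|^2 + dt^2) / t^2\<close>.\<close>

definition hyp_space :: "(complex \<times> real) set" where
  "hyp_space = {(z, t). t > 0}"

definition hyp_dist :: "complex \<times> real \<Rightarrow> complex \<times> real \<Rightarrow> real" where
  "hyp_dist p q = arcosh (1 + (dist p q)\<^sup>2 / (2 * snd p * snd q))"

definition hyp_volume :: "(complex \<times> real) measure" where
  "hyp_volume = density (restrict_space lborel hyp_space) (\<lambda>(z, t). ennreal (1 / t ^ 3))"

text \<open>A manifold is given as a metric space \<open>M\<close> carrying its Riemannian distance; the predicate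
  below says that the distance is the infimum of the lengths of the paths joining two points.\<close>

definition length_metric :: "'m metric \<Rightarrow> bool" where
  "length_metric M \<longleftrightarrow>
     (\<forall>x\<in>mspace M. \<forall>y\<in>mspace M. \<forall>\<epsilon>>0. \<exists>\<gamma>.
        continuous_map (top_of_set {0..1::real}) (mtopology_of M) \<gamma> \<and> \<gamma> 0 = x \<and> \<gamma> 1 = y \<and>
        (\<forall>(n::nat) s. mono_on {..n} s \<and> s ` {..n} \<subseteq> {0..1} \<longrightarrow>
           (\<Sum>i<n. mdist M (\<gamma> (s i)) (\<gamma> (s (Suc i)))) \<le> mdist M x y + \<epsilon>))"

definition hyp_chart ::
  "'m metric \<Rightarrow> 'm \<Rightarrow> real \<Rightarrow> complex \<times> real \<Rightarrow> ('m \<Rightarrow> complex \<times> real) \<Rightarrow> bool" where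
  "hyp_chart M x r p f \<longleftrightarrow>
     x \<in> mspace M \<and> p \<in> hyp_space \<and> 0 < r \<and>
     bij_betw f (mball_of M x r) {q \<in> hyp_space. hyp_dist p q < r} \<and>
     (\<forall>y\<in>mball_of M x r. \<forall>z\<in>mball_of M x r. hyp_dist (f y) (f z) = mdist M y z)"

definition complete_hyperbolic_3_manifold :: "'m metric \<Rightarrow> bool" where
  "complete_hyperbolic_3_manifold M \<longleftrightarrow>
     mspace M \<noteq> {} \<and> length_metric M \<and> mcomplete_of M \<and>
     (\<forall>x\<in>mspace M. \<exists>r p f. hyp_chart M x r p f)"

text \<open>The Riemannian volume is the Borel measure that hyperbolic charts carry to hyperbolic
  volume.\<close>

definition finite_hyp_volume :: "'m metric \<Rightarrow> bool" where
  "finite_hyp_volume M \<longleftrightarrow>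
     (\<exists>\<mu>. space \<mu> = mspace M \<and> sets \<mu> = sigma_sets (mspace M) {U. openin (mtopology_of M) U} \<and>
        (\<forall>x r p f S. hyp_chart M x r p f \<and> S \<in> sets \<mu> \<and> S \<subseteq> mball_of M x r \<longrightarrow>
           emeasure \<mu> S = emeasure hyp_volume (f ` S)) \<and>
        emeasure \<mu> (mspace M) < \<infinity>)"

text \<open>A cusp is the quotient of a horoball (normalised to \<open>{t > 1}\<close>) by a cocompact group \<open>G\<close> of
  isometries of the plane acting horizontally; \<open>f\<close> is the quotient map. As \<open>f\<close> is a local
  isometry, the action of \<open>G\<close> is free and properly discontinuous, so a cross-section is a flat
  torus or Klein bottle.\<close>

definition is_cusp :: "'m metric \<Rightarrow> 'm set \<Rightarrow> bool" where
  "is_cusp M C \<longleftrightarrow>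
     (\<exists>(G :: (complex \<Rightarrow> complex) set) (f :: complex \<times> real \<Rightarrow> 'm).
        id \<in> G \<and> (\<forall>g\<in>G. \<forall>h\<in>G. g \<circ> h \<in> G) \<and> (\<forall>g\<in>G. \<exists>h\<in>G. g \<circ> h = id \<and> h \<circ> g = id) \<and>
        (\<forall>g\<in>G. \<forall>z w. dist (g z) (g w) = dist z w) \<and>
        (\<exists>R. \<forall>z. \<exists>g\<in>G. cmod (g z) \<le> R) \<and>
        C \<subseteq> mspace M \<and> f ` {(z, t). t > 1} = C \<and>
        (\<forall>z t w s. t > 1 \<and> s > 1 \<longrightarrow>
           (f (z, t) = f (w, s) \<longleftrightarrow> t = s \<and> (\<exists>g\<in>G. w = g z))) \<and>
        (\<forall>p. snd p > 1 \<longrightarrow> (\<exists>r>0. \<forall>q q'. snd q > 1 \<and> snd q' > 1 \<and>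
           hyp_dist p q < r \<and> hyp_dist p q' < r \<longrightarrow> mdist M (f q) (f q') = hyp_dist q q')))"

definition all_ends_cusps :: "'m metric \<Rightarrow> bool" where
  "all_ends_cusps M \<longleftrightarrow>
     (\<exists>\<C>. finite \<C> \<and> disjoint \<C> \<and> (\<forall>C\<in>\<C>. is_cusp M C) \<and>
        compactin (mtopology_of M) (mspace M - \<Union>\<C>))"

definition hyperbolic_3_manifold_with_cusp_ends :: "'m metric \<Rightarrow> bool" where
  "hyperbolic_3_manifold_with_cusp_ends M \<longleftrightarrow>
     complete_hyperbolic_3_manifold M \<and> finite_hyp_volume M \<and> all_ends_cusps M"


section \<open>Ideal triangulations\<close>

text \<open>The tetrahedra are the elements of a finite type \<open>'t\<close>, and the vertices of each tetrahedron
  are \<open>0, 1, 2, 3 :: 4\<close>. If \<open>glue t i = (t', \<pi>)\<close>, the face of \<open>t\<close> opposite to \<open>i\<close> is glued to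
  the face of \<open>t'\<close> opposite to \<open>\<pi> i\<close> by the affine map that sends each vertex \<open>j \<noteq> i\<close> to
  \<open>\<pi> j\<close>.\<close>

type_synonym 't gluing = "'t \<Rightarrow> 4 \<Rightarrow> 't \<times> (4 \<Rightarrow> 4)"

definition face_pairing :: "'t gluing \<Rightarrow> bool" where
  "face_pairing glue \<longleftrightarrow>
     (\<forall>t i. case glue t i of (t', \<pi>) \<Rightarrow>
        bij \<pi> \<and> (t', \<pi> i) \<noteq> (t, i) \<and> glue t' (\<pi> i) = (t, inv \<pi>))"

definition generated_equiv :: "('a \<times> 'a) set \<Rightarrow> ('a \<times> 'a) set" where
  "generated_equiv r = (r \<union> r\<inverse>)\<^sup>*"

definition std_simplex :: "(real ^ 4) set" where
  "std_simplex = {x. (\<forall>i. 0 \<le> x $ i) \<and> (\<Sum>i\<in>UNIV. x $ i) = 1}"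

definition point_equiv :: "'t gluing \<Rightarrow> (('t \<times> (real ^ 4)) \<times> ('t \<times> (real ^ 4))) set" where
  "point_equiv glue = generated_equiv
     {((t, x), (t', \<chi> j. x $ inv \<pi> j)) | t x t' \<pi> i.
        x \<in> std_simplex \<and> x $ i = 0 \<and> glue t i = (t', \<pi>)}"

definition quotient_topology :: "'a topology \<Rightarrow> ('a \<times> 'a) set \<Rightarrow> 'a set topology" where
  "quotient_topology X r =
     topology (\<lambda>U. U \<subseteq> topspace X // r \<and> openin X {x \<in> topspace X. r `` {x} \<in> U})"

lemma openin_quotient_topology:
  "openin (quotient_topology X r) U \<longleftrightarrow>
     U \<subseteq> topspace X // r \<and> openin X {x \<in> topspace X. r `` {x} \<in> U}"
proof -
  have "istopology (\<lambda>U. U \<subseteq> topspace X // r \<and> openin X {x \<in> topspace X. r `` {x} \<in> U})"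
    unfolding istopology_def
  proof (intro conjI allI impI)
    fix S T
    assume S: "S \<subseteq> topspace X // r \<and> openin X {x \<in> topspace X. r `` {x} \<in> S}"
      and T: "T \<subseteq> topspace X // r \<and> openin X {x \<in> topspace X. r `` {x} \<in> T}"
    show "S \<inter> T \<subseteq> topspace X // r" using S by blast
    have "{x \<in> topspace X. r `` {x} \<in> S \<inter> T}
        = {x \<in> topspace X. r `` {x} \<in> S} \<inter> {x \<in> topspace X. r `` {x} \<in> T}" by blast
    then show "openin X {x \<in> topspace X. r `` {x} \<in> S \<inter> T}" using S T by auto
  next
    fix K
    assume K: "\<forall>S\<in>K. S \<subseteq> topspace X // r \<and> openin X {x \<in> topspace X. r `` {x} \<in> S}"
    show "\<Union>K \<subseteq> topspace X // r" using K by blast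
    have "{x \<in> topspace X. r `` {x} \<in> \<Union>K}
        = (\<Union>S\<in>K. {x \<in> topspace X. r `` {x} \<in> S})" by blast
    then show "openin X {x \<in> topspace X. r `` {x} \<in> \<Union>K}" using K by auto
  qed
  then show ?thesis
    unfolding quotient_topology_def by (simp add: topology_inverse')
qed

definition glued_space :: "'t gluing \<Rightarrow> ('t \<times> (real ^ 4)) set topology" where
  "glued_space glue = quotient_topology
     (prod_topology (discrete_topology UNIV) (top_of_set std_simplex)) (point_equiv glue)"

definition glued_space_minus_vertices :: "'t gluing \<Rightarrow> ('t \<times> (real ^ 4)) set topology" where
  "glued_space_minus_vertices glue =
     subtopology (glued_space glue) (- {point_equiv glue `` {(t, axis k 1)} | t k. True})"

definition ideal_triangulation :: "'t::finite gluing \<Rightarrow> 'm metric \<Rightarrow> bool" where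
  "ideal_triangulation glue M \<longleftrightarrow>
     face_pairing glue \<and> glued_space_minus_vertices glue homeomorphic_space mtopology_of M"

text \<open>A face of the tetrahedron \<open>t\<close> spanned by \<open>s :: 4 set\<close> is written \<open>(t, s)\<close>. Vertices and edges
  of the triangulation are classes of such pairs with \<open>card s = 1\<close> and \<open>card s = 2\<close>. The corners
  are the pairs with \<open>card s = 2\<close>, so an edge is literally the set of corners around it. A vertex
  of the triangulation stands for the boundary component of \<open>M\<close> obtained by truncating it.\<close>

type_synonym 't cell = "('t \<times> 4 set) set"

definition cell_equiv :: "'t gluing \<Rightarrow> (('t \<times> 4 set) \<times> ('t \<times> 4 set)) set" where
  "cell_equiv glue = generated_equiv
     {((t, s), (t', \<pi> ` s)) | t s t' \<pi> i. i \<notin> s \<and> glue t i = (t', \<pi>)}"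

definition cell_of :: "'t gluing \<Rightarrow> 't \<Rightarrow> 4 set \<Rightarrow> 't cell" where
  "cell_of glue t s = cell_equiv glue `` {(t, s)}"

definition corners :: "('t \<times> 4 set) set" where
  "corners = {(t, s). card s = 2}"

definition edges :: "'t gluing \<Rightarrow> 't cell set" where
  "edges glue = corners // cell_equiv glue"

definition boundary_components :: "'t gluing \<Rightarrow> 't cell set" where
  "boundary_components glue = {(t, s). card s = 1} // cell_equiv glue"

definition angle_structure :: "'t gluing \<Rightarrow> ('t \<times> 4 set \<Rightarrow> real) \<Rightarrow> bool" where
  "angle_structure glue \<theta> \<longleftrightarrow>
     (\<forall>c\<in>corners. 0 < \<theta> c \<and> \<theta> c < pi) \<and>
     (\<forall>t i. (\<Sum>j\<in>UNIV - {i}. \<theta> (t, {i, j})) = pi) \<and>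
     (\<forall>e\<in>edges glue. (\<Sum>c\<in>e. \<theta> c) = 2 * pi)"

text \<open>The number \<open>|e \<inter> v|\<close> of ends of \<open>e\<close> at \<open>v\<close> is read off at any one corner of \<open>e\<close>.\<close>

definition corner_ends :: "'t gluing \<Rightarrow> 't cell \<Rightarrow> 't \<times> 4 set \<Rightarrow> nat" where
  "corner_ends glue v c = card {i \<in> snd c. cell_of glue (fst c) {i} = v}"

definition edge_ends :: "'t gluing \<Rightarrow> 't cell \<Rightarrow> 't cell \<Rightarrow> nat" where
  "edge_ends glue e v = corner_ends glue v (SOME c. c \<in> e)"

lemma cell_of_glue:
  assumes "glue t i = (t', \<pi>)" "i \<notin> s"
  shows "cell_of glue t' (\<pi> ` s) = cell_of glue t s"
proof -
  let ?r = "{((t, s), (t', \<pi> ` s)) | t s t' \<pi> i. i \<notin> s \<and> glue t i = (t', \<pi>)}"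
  have "((t, s), (t', \<pi> ` s)) \<in> ?r" using assms by blast
  then have "((t, s), (t', \<pi> ` s)) \<in> ?r \<union> ?r\<inverse>" "((t', \<pi> ` s), (t, s)) \<in> ?r \<union> ?r\<inverse>"
    by (simp_all only: Un_iff converse_iff simp_thms)
  then have "((t, s), (t', \<pi> ` s)) \<in> cell_equiv glue" "((t', \<pi> ` s), (t, s)) \<in> cell_equiv glue"
    unfolding cell_equiv_def generated_equiv_def by (simp_all only: r_into_rtrancl)
  moreover have "trans (cell_equiv glue)"
    unfolding cell_equiv_def generated_equiv_def by (rule trans_rtrancl)
  ultimately show ?thesis
    unfolding cell_of_def trans_def by blast
qed

lemma corner_ends_glue:
  assumes "face_pairing glue" "glue t i = (t', \<pi>)" "i \<notin> s"
  shows "corner_ends glue v (t', \<pi> ` s) = corner_ends glue v (t, s)"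
proof -
  have inj: "inj \<pi>"
    using assms(1)[unfolded face_pairing_def, THEN spec, THEN spec, where x1 = t and x = i] assms(2)
    by (simp add: bij_is_inj)
  have *: "cell_of glue t' {\<pi> j} = cell_of glue t {j}" if "j \<in> s" for j
  proof -
    have "i \<notin> {j}" using that assms(3) by blast
    with cell_of_glue[of glue t i t' \<pi> "{j}"] assms(2) show ?thesis by simp
  qed
  have "{k \<in> \<pi> ` s. cell_of glue t' {k} = v} = \<pi> ` {j \<in> s. cell_of glue t {j} = v}"
  proof (intro set_eqI iffI)
    fix k assume "k \<in> {k \<in> \<pi> ` s. cell_of glue t' {k} = v}"
    then obtain j where "j \<in> s" "k = \<pi> j" "cell_of glue t' {\<pi> j} = v" by blast
    then show "k \<in> \<pi> ` {j \<in> s. cell_of glue t {j} = v}" using *[of j] by blast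
  next
    fix k assume "k \<in> \<pi> ` {j \<in> s. cell_of glue t {j} = v}"
    then obtain j where "j \<in> s" "k = \<pi> j" "cell_of glue t {j} = v" by blast
    then show "k \<in> {k \<in> \<pi> ` s. cell_of glue t' {k} = v}" using *[of j] by simp
  qed
  then show ?thesis
    unfolding corner_ends_def by (simp add: card_image inj_on_subset[OF inj])
qed

lemma edge_ends_eq:
  assumes "face_pairing glue" "e \<in> edges glue" "c \<in> e"
  shows "edge_ends glue e v = corner_ends glue v c"
proof -
  let ?r = "{((t, s), (t', \<pi> ` s)) | t s t' \<pi> i. i \<notin> s \<and> glue t i = (t', \<pi>)}"
  have *: "corner_ends glue v d = corner_ends glue v c" if "(c, d) \<in> (?r \<union> ?r\<inverse>)\<^sup>*" for c d
    using that
  proof induction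
    case (step y z)
    from step.hyps(2) have "corner_ends glue v z = corner_ends glue v y"
    proof
      assume "(y, z) \<in> ?r"
      then obtain t s t' \<pi> i where "y = (t, s)" "z = (t', \<pi> ` s)" "i \<notin> s" "glue t i = (t', \<pi>)"
        by blast
      then show ?thesis using corner_ends_glue[OF assms(1), of t i t' \<pi> s v] by simp
    next
      assume "(y, z) \<in> ?r\<inverse>"
      then have "(z, y) \<in> ?r" by (rule converseD)
      then obtain t s t' \<pi> i where "z = (t, s)" "y = (t', \<pi> ` s)" "i \<notin> s" "glue t i = (t', \<pi>)"
        by blast
      then show ?thesis using corner_ends_glue[OF assms(1), of t i t' \<pi> s v] by simp
    qed
    then show ?case using step.IH by simp
  qed simp
  obtain c0 where c0: "e = cell_equiv glue `` {c0}"
    using assms(2) unfolding edges_def by (auto elim: quotientE)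
  have "corner_ends glue v d = corner_ends glue v c0" if "d \<in> e" for d
  proof -
    have "(c0, d) \<in> (?r \<union> ?r\<inverse>)\<^sup>*"
      using that unfolding c0 cell_equiv_def generated_equiv_def by (rule ImageE) simp
    then show ?thesis by (rule *)
  qed
  moreover have "(SOME c. c \<in> e) \<in> e" using assms(3) by (rule someI)
  ultimately show ?thesis
    using assms(3) unfolding edge_ends_def by presburger
qed


section \<open>The ideal 6j symbol\<close>

definition Q :: "real \<Rightarrow> real" where
  "Q b = b + 1 / b"

definition T_fun :: "real \<Rightarrow> complex \<Rightarrow> complex" where
  "T_fun b z = exp (- (of_real pi * \<i> / 2) *
     (z\<^sup>2 - of_real (Q b) * z + of_real (((Q b)\<^sup>2 + 1) / 6)))"

definition T_sqrt :: "real \<Rightarrow> complex \<Rightarrow> complex" where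
  "T_sqrt b z = exp (- (of_real pi * \<i> / 4) *
     (z\<^sup>2 - of_real (Q b) * z + of_real (((Q b)\<^sup>2 + 1) / 6)))"

text \<open>The contour \<open>\<Omega>\<close> follows the real line except for the upper half circle of radius \<open>\<pi> b\<close>
  around \<open>0\<close>; for \<open>0 < b < 1\<close> the poles of the integrand other than \<open>0\<close> have modulus at least
  \<open>2 \<pi> b\<close>.\<close>

definition \<Omega>_integral :: "real \<Rightarrow> (complex \<Rightarrow> complex) \<Rightarrow> complex" where
  "\<Omega>_integral b f =
     (LINT t:{..- (pi * b)}|lborel. f (of_real t)) +
     contour_integral (part_circlepath 0 (pi * b) pi 0) f +
     (LINT t:{pi * b..}|lborel. f (of_real t))"

definition S_fun :: "real \<Rightarrow> complex \<Rightarrow> complex" where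
  "S_fun b z = exp (\<Omega>_integral b
     (\<lambda>t. sinh ((of_real (Q b) / 2 - z) * t) /
       (4 * t * sinh (of_real b * t / 2) * sinh (t / (2 * of_real b)))))"

text \<open>Here \<open>\<Gamma>\<close> is the vertical line with real part \<open>c\<close>.\<close>

definition ideal_6j ::
  "real \<Rightarrow> real \<Rightarrow> complex \<Rightarrow> complex \<Rightarrow> complex \<Rightarrow> complex \<Rightarrow> complex \<Rightarrow> complex \<Rightarrow> complex" where
  "ideal_6j b c a1 a2 a3 a4 a5 a6 =
     (let ts = [a1 + a2 + a3, a1 + a5 + a6, a2 + a4 + a6, a3 + a4 + a5];
          qs = [a1 + a2 + a4 + a5, a1 + a3 + a4 + a6, a2 + a3 + a5 + a6]
      in (\<Prod>t\<leftarrow>ts. T_sqrt b (of_real (2 * Q b) - t)) / (\<Prod>t\<leftarrow>ts. \<Prod>q\<leftarrow>qs. T_sqrt b (q - t)) *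
         (LINT y|lborel. (let u = Complex c y in
            (\<Prod>t\<leftarrow>ts. T_fun b (u - t)) / T_fun b (of_real (2 * Q b) - u) * (\<Prod>q\<leftarrow>qs. S_fun b (q - u)))))"


section \<open>The state integral\<close>

definition edge_weight :: "real \<Rightarrow> complex \<Rightarrow> real" where
  "edge_weight b z = (cmod (T_fun b (2 * z)))\<^sup>2"

text \<open>\<open>ideal_6j\<close> is invariant under the permutations of its arguments induced by permutations of
  the vertices of the tetrahedron, so the numbering of the edges is immaterial as long as the
  first three bound a face and the last three are the respective opposite edges.\<close>

definition tetrahedron_weight ::
  "real \<Rightarrow> real \<Rightarrow> 't gluing \<Rightarrow> ('t cell \<Rightarrow> complex) \<Rightarrow> 't \<Rightarrow> complex" where
  "tetrahedron_weight b c glue a t =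
     (let \<alpha> = (\<lambda>i j. a (cell_of glue t {i, j}))
      in ideal_6j b c (\<alpha> 0 1) (\<alpha> 0 2) (\<alpha> 1 2) (\<alpha> 2 3) (\<alpha> 1 3) (\<alpha> 0 3))"

text \<open>A point \<open>a\<close> of \<open>(Q/2 + \<i> \<real>)^E\<close> is represented by its imaginary part, and \<open>\<real>^E\<close> and \<open>\<real>^V\<close>
  by coordinate subspaces of a Euclidean space.\<close>

definition state_integrand :: "real \<Rightarrow> real \<Rightarrow> 't::finite gluing \<Rightarrow> real ^ 't cell \<Rightarrow> complex" where
  "state_integrand b c glue y =
     (let a = (\<lambda>e. Complex (Q b / 2) (y $ e))
      in (\<Prod>e\<in>edges glue. of_real (edge_weight b (a e))) *
         (\<Prod>t\<in>UNIV. tetrahedron_weight b c glue a t))"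

definition coordinate_subspace :: "'n::finite set \<Rightarrow> (real ^ 'n) set" where
  "coordinate_subspace I = {x. \<forall>i. i \<notin> I \<longrightarrow> x $ i = 0}"

definition incidence_map :: "'t::finite gluing \<Rightarrow> real ^ 't cell \<Rightarrow> real ^ 't cell" where
  "incidence_map glue u = (\<chi> e. if e \<in> edges glue
     then \<Sum>v\<in>boundary_components glue. real (edge_ends glue e v) * u $ v else 0)"

text \<open>The slice \<open>X\<close>: the orthogonal complement of \<open>A(\<real>^V)\<close> in \<open>\<real>^E\<close>.\<close>

definition orbit_slice :: "'t::finite gluing \<Rightarrow> (real ^ 't cell) set" where
  "orbit_slice glue = coordinate_subspace (edges glue) \<inter>
     (incidence_map glue ` coordinate_subspace (boundary_components glue))\<^sup>\<bottom>"

text \<open>Induced Lebesgue measure on a linear subspace, defined like \<open>lborel\<close> itself but from an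
  orthonormal basis of the subspace; by rotation invariance the choice of the basis is
  immaterial.\<close>

definition orthonormal_basis_of :: "'a::euclidean_space set \<Rightarrow> 'a set \<Rightarrow> bool" where
  "orthonormal_basis_of X B \<longleftrightarrow>
     B \<subseteq> X \<and> pairwise orthogonal B \<and> (\<forall>x\<in>B. norm x = 1) \<and> span B = X"

definition subspace_lborel :: "'a::euclidean_space set \<Rightarrow> 'a measure" where
  "subspace_lborel X = (let B = (SOME B. orthonormal_basis_of X B)
     in distr (\<Pi>\<^sub>M b\<in>B. (lborel :: real measure)) (restrict_space borel X)
          (\<lambda>f. \<Sum>b\<in>B. f b *\<^sub>R b))"

text \<open>Leibniz expansion of the determinant of the \<open>V \<times> V\<close> matrix \<open>A\<^sup>T A\<close>; the determinant of the
  library needs a type as index set.\<close>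

definition gram_det :: "'t::finite gluing \<Rightarrow> real" where
  "gram_det glue = (\<Sum>p | p permutes boundary_components glue. of_int (sign p) *
     (\<Prod>v\<in>boundary_components glue.
        \<Sum>e\<in>edges glue. real (edge_ends glue e v) * real (edge_ends glue e (p v))))"

text \<open>The measure \<open>\<mu>\<close> on the orbit space, carried over to the slice \<open>X\<close>, which meets each orbit in
  exactly one point.\<close>

definition orbit_measure :: "real \<Rightarrow> 't::finite gluing \<Rightarrow> (real ^ 't cell) measure" where
  "orbit_measure b glue = scale_measure
     (ennreal ((1 / (2 * pi * b)) ^ card (boundary_components glue) * sqrt (gram_det glue)))
     (subspace_lborel (orbit_slice glue))"

end

theory Submission
  imports Defs "HOL-Complex_Analysis.Cauchy_Integral_Formula" "HOL-Real_Asymp.Real_Asymp"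
begin

text \<open>
  The integrand of the state integral is dominated, on the slice \<open>X\<close>, by a multiple of
  \<open>exp (- k * norm x)\<close> with \<open>k > 0\<close>.

  The double sine function satisfies
  \<open>cmod (S_fun b z) \<le> C * exp (- pi * \<bar>Im z\<bar> * (Q b / 2 - Re z))\<close> uniformly on
  \<open>p0 \<le> Re z \<le> Q b / 2\<close> for each \<open>p0 > 0\<close> (\<open>S_fun_bound\<close>): splitting the hyperbolic sine in its
  defining integral into exponentials, each of the two pieces is bounded for
  one sign of \<open>Im z\<close>, and their sum is a residue at the origin, a quadratic polynomial, which is responsible for the
  exponential decay. Write \<open>a_i = Q b / 2 + \<i> y_i\<close>, \<open>s_j = y_j + y_(j+3)\<close>, \<open>S = s_1 + s_2 + s_3\<close>,
  \<open>m = max s_j\<close>, and let the contour of the ideal 6j symbol have real part \<open>2 * Q b - d\<close>, where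
  \<open>0 < d < Q b / 6\<close>. The logarithm of the modulus of the integrand of the 6j symbol is then, up to
  an additive constant, at most \<open>pi\<close> times a concave piecewise linear function of the imaginary
  part of the variable of integration, and taking its maximum gives
  \<open>cmod (ideal_6j \<dots>) \<le> C * exp (pi * (- 2 * d * S + (6 * d - Q b) * m))\<close> (\<open>ideal_6j_bound\<close>).

  The edge weights contribute \<open>exp (2 * pi * Q b * (\<Sum>e. x_e))\<close>. As the angles \<open>\<theta>\<close> of an angle
  structure add up to \<open>2 * pi\<close> around each edge, this distributes over the tetrahedra as
  \<open>Q b * (\<Sum>j. \<theta>_j * s_j)\<close>, where \<open>\<theta>_j\<close> is the common angle at the \<open>j\<close>-th pair of opposite edges.
  Since \<open>\<theta>_1 + \<theta>_2 + \<theta>_3 = pi\<close>, the total exponent of a tetrahedron is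
  \<open>- (\<Sum>j. (Q b * \<theta>_j - 2 * pi * d) * (m - s_j))\<close>. All coefficients are positive once \<open>d\<close> is small
  enough, which is harmless because the 6j symbol does not depend on the contour
  (\<open>ideal_6j_contour_independent\<close>). The integrand is therefore at most a multiple of
  \<open>exp (- k * (\<Sum>t. shape_defect glue x t))\<close>, where the shape defect of a tetrahedron is
  \<open>3 * m - S\<close> (\<open>state_integrand_bound\<close>).

  If all shape defects vanish, then \<open>x\<close> lies in the image of the incidence map: in each
  tetrahedron the three sums \<open>s_j\<close> coincide, so that \<open>y_ij = w_i + w_j\<close> for vertex weights
  \<open>w_i = (y_ij + y_ik - y_jk) / 2\<close> that can be read off at any face and so agree under the gluing
  (\<open>shape_defect_zero_imp_orbit\<close>). On the orthogonal complement \<open>X\<close> of this image the total shape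
  defect is hence positive away from \<open>0\<close>, and being continuous and positively homogeneous it
  dominates a multiple of the norm.
\<close>

section \<open>Parametric integrals and integrals along vertical lines\<close>

text \<open>A locally dominated integral of holomorphic functions is holomorphic. By Cauchy's inequality the
  difference quotients are dominated as well, so that one can differentiate under the integral.\<close>

lemma holomorphic_on_lebesgue_integral:
  fixes f :: "complex \<Rightarrow> 'a \<Rightarrow> complex"
  assumes hol: "\<And>t. t \<in> space M \<Longrightarrow> (\<lambda>z. f z t) holomorphic_on S"
    and meas: "\<And>z. z \<in> S \<Longrightarrow> f z \<in> borel_measurable M"
    and dom: "\<And>z. z \<in> S \<Longrightarrow> \<exists>r>0. \<exists>g. cball z r \<subseteq> S \<and> integrable M g \<and>
                (\<forall>w\<in>cball z r. \<forall>t\<in>space M. cmod (f w t) \<le> g t)"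
  shows "(\<lambda>z. LINT t|M. f z t) holomorphic_on S"
proof -
  have "(\<lambda>z. LINT t|M. f z t) field_differentiable (at z)" if z: "z \<in> S" for z
  proof -
    obtain r g where r: "r > 0" "cball z r \<subseteq> S" and g: "integrable M g"
      and fg: "\<And>w t. w \<in> cball z r \<Longrightarrow> t \<in> space M \<Longrightarrow> cmod (f w t) \<le> g t"
      using dom[OF z] by metis
    define U where "U = ball z (r / 2)"
    have US: "U \<subseteq> S" "z \<in> U" "open U" using r by (auto simp: U_def)
    have int: "integrable M (f w)" if "w \<in> cball z r" for w
      by (rule Bochner_Integration.integrable_bound[OF g])
         (use meas[of w] r fg that in \<open>force intro!: AE_I2\<close>)+
    have Cauchy: "cmod (f w t - f z t) \<le> g t * (2 / r) * cmod (w - z)" if w: "w \<in> U"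
      and t: "t \<in> space M" for w t
    proof (rule field_differentiable_bound[of U])
      show "convex U" by (simp add: U_def)
      fix v assume v: "v \<in> U"
      have cb: "cball v (r / 2) \<subseteq> cball z r"
      proof
        fix x assume "x \<in> cball v (r/2)"
        then show "x \<in> cball z r" using v dist_triangle[of z x v] by (auto simp: U_def)
      qed
      have "(\<lambda>z. f z t) holomorphic_on ball v (r/2)" "continuous_on (cball v (r/2)) (\<lambda>z. f z t)"
        using hol[OF t] cb r(2) by
          (meson ball_subset_cball holomorphic_on_subset order_trans holomorphic_on_imp_continuous_on)+
      then have "cmod ((deriv ^^ 1) (\<lambda>z. f z t) v) \<le> fact 1 * g t / (r/2) ^ 1"
        by (rule Cauchy_inequality) (use r cb fg t in \<open>auto simp: dist_norm intro!: fg\<close>)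
      then show "cmod (deriv (\<lambda>z. f z t) v) \<le> g t * (2 / r)" by simp
      show "((\<lambda>z. f z t) has_field_derivative deriv (\<lambda>z. f z t) v) (at v within U)"
        using hol[OF t] US v 
        by (meson DERIV_deriv_iff_field_differentiable has_field_derivative_at_within holomorphic_on_imp_differentiable_at holomorphic_on_subset)
    qed (use US w in auto)
    define f' where "f' = (\<lambda>t. deriv (\<lambda>z. f z t) z)"
    have lim: "((\<lambda>w. (f w t - f z t) / (w - z)) \<longlongrightarrow> f' t) (at z within U)" if t: "t \<in> space M" for t
    proof -
      have "((\<lambda>z. f z t) has_field_derivative f' t) (at z within U)"
        unfolding f'_def using hol[OF t] US
        by (meson DERIV_deriv_iff_field_differentiable has_field_derivative_at_within holomorphic_on_imp_differentiable_at holomorphic_on_subset)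
      then show ?thesis by (simp add: has_field_derivative_iff)
    qed
    have "((\<lambda>w. ((LINT t|M. f w t) - (LINT t|M. f z t)) / (w - z))
        \<longlongrightarrow> (LINT t|M. f' t)) (at z within U)"
      unfolding tendsto_at_iff_sequentially o_def
    proof (intro allI impI)
      fix X assume X: "\<forall>i. X i \<in> U - {z}" "X \<longlonglongrightarrow> z"
      have Xr: "X i \<in> cball z r" "z \<in> cball z r" for i using X(1) r
        by (auto simp: U_def dest!: spec[of _ i])
      have lim': "(\<lambda>i. (f (X i) t - f z t) / (X i - z)) \<longlonglongrightarrow> f' t" if "t \<in> space M" for t
        using lim[OF that] X unfolding tendsto_at_iff_sequentially o_def by blast
      have ms: "(\<lambda>t. (f (X i) t - f z t) / (X i - z)) \<in> borel_measurable M" for i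
        using meas[of "X i"] meas[of z] z Xr(1)[of i] r
          by (intro borel_measurable_divide borel_measurable_diff) auto
      have conv: "(\<lambda>i. LINT t|M. (f (X i) t - f z t) / (X i - z)) \<longlonglongrightarrow> (LINT t|M. f' t)"
      proof (rule integral_dominated_convergence)
        show "f' \<in> borel_measurable M"
          by (rule borel_measurable_LIMSEQ_metric[OF ms lim'])
        show "integrable M (\<lambda>t. g t * (2 / r))" using g by simp
        show "AE t in M. (\<lambda>i. (f (X i) t - f z t) / (X i - z)) \<longlonglongrightarrow> f' t"
          using lim' by simp
        show "AE t in M. norm ((f (X i) t - f z t) / (X i - z)) \<le> g t * (2 / r)" for i
        proof (rule AE_I2)
          fix t assume t: "t \<in> space M"
          have "X i \<in> U" "X i - z \<noteq> 0" using X(1) by auto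
          with Cauchy[OF _ t, of "X i"] show "norm ((f (X i) t - f z t) / (X i - z))
              \<le> g t * (2 / r)"
            by (simp add: norm_divide divide_le_eq)
        qed
      qed (rule ms)
      moreover have "(LINT t|M. (f (X i) t - f z t) / (X i - z))
          = ((LINT t|M. f (X i) t) - (LINT t|M. f z t)) / (X i - z)" for i
        using int Xr by simp
      ultimately show "(\<lambda>i. ((LINT t|M. f (X i) t) - (LINT t|M. f z t)) / (X i - z))
          \<longlonglongrightarrow> (LINT t|M. f' t)"
        by (simp only:)
    qed
    then have "((\<lambda>z. LINT t|M. f z t) has_field_derivative (LINT t|M. f' t)) (at z within U)"
      by (simp add: has_field_derivative_iff)
    then show ?thesis
      using US by (metis at_within_open field_differentiable_def)
  qed
  then show ?thesis
    by (meson field_differentiable_at_within holomorphic_on_def)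
qed

lemma integrable_exp_abs:
  fixes k :: real assumes "k > 0"
  shows "integrable lborel (\<lambda>x. exp (- k * \<bar>x\<bar>))"
proof -
  have half: "(\<integral>\<^sup>+x. ennreal (exp (- k * x)) * indicator {0..} x \<partial>lborel) = ennreal (1 / k)"
  proof -
    have "(\<integral>\<^sup>+x. ennreal (exp (- k * x)) * indicator {0..} x \<partial>lborel)
        = ennreal (0 - (- exp (- k * 0) / k))"
    proof (rule nn_integral_FTC_atLeast[where F="\<lambda>x. - exp (- k * x) / k"])
      show "((\<lambda>x. - exp (- k * x) / k) \<longlongrightarrow> 0) at_top"
        using assms by real_asymp
    qed (use assms in \<open>auto intro!: derivative_eq_intros\<close>)
    then show ?thesis by simp
  qed
  have pos: "integrable lborel (\<lambda>x. indicator {0..} x *\<^sub>R exp (- k * x))"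
    unfolding integrable_iff_bounded 
  proof
    have "(\<integral>\<^sup>+x. ennreal (norm (indicator {0..} x *\<^sub>R exp (- k * x))) \<partial>lborel)
        = (\<integral>\<^sup>+x. ennreal (exp (- k * x)) * indicator {0..} x \<partial>lborel)"
      by (intro nn_integral_cong) (auto simp: indicator_def)
    then show "(\<integral>\<^sup>+x. ennreal (norm (indicator {0..} x *\<^sub>R exp (- k * x))) \<partial>lborel) < \<infinity>"
      unfolding half by simp
  qed simp
  have neg: "integrable lborel (\<lambda>x. indicator {0..} (0 + (-1) * x) *\<^sub>R exp (- k * (0 + (-1) * x)))"
    by (rule lborel_integrable_real_affine[OF pos]) simp
  show ?thesis
    by (rule Bochner_Integration.integrable_bound[OF Bochner_Integration.integrable_add[OF pos neg]])
       (auto intro!: AE_I2 simp: indicator_def)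
qed

text \<open>The integrals along two vertical lines agree if the function decays exponentially in between. A
  primitive on the strip replaces the contour integral around a rectangle: the horizontal sides
  become differences of its values, which tend to zero.\<close>

lemma vertical_line_integral_cong:
  fixes g :: "complex \<Rightarrow> complex"
  assumes hol: "g holomorphic_on {z. l < Re z \<and> Re z < u}"
    and lu: "l < c" "c \<le> c'" "c' < u" and k: "k > 0"
    and bound: "\<And>x y. c \<le> x \<Longrightarrow> x \<le> c' \<Longrightarrow> cmod (g (Complex x y)) \<le> B * exp (- k * \<bar>y\<bar>)"
  shows "(LINT y|lborel. g (Complex c y)) = (LINT y|lborel. g (Complex c' y))"
proof -
  let ?S = "{z. l < Re z \<and> Re z < u}"
  have S: "?S = {z. l < Re z} \<inter> {z. Re z < u}" by auto
  have cvx: "convex ?S" unfolding S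
    by (intro convex_Int convex_halfspace_Re_gt convex_halfspace_Re_lt)
  have op: "open ?S" unfolding S by (intro open_Int open_halfspace_Re_gt open_halfspace_Re_lt)
  obtain G where G: "\<And>z. z \<in> ?S \<Longrightarrow> (G has_field_derivative g z) (at z within ?S)"
  proof (rule holomorphic_convex_primitive'[OF cvx op hol], goal_cases)
    case (1 G)
    show thesis by (rule that) (rule 1)
  qed
  have G': "(G has_field_derivative g z) (at z)" if "z \<in> ?S" for z
    using G[OF that] by (simp only: at_within_open[OF that op])
  have int: "integrable lborel (\<lambda>y. g (Complex x y))" if x: "c \<le> x" "x \<le> c'" for x
  proof (rule Bochner_Integration.integrable_bound)
    show "integrable lborel (\<lambda>y. B * exp (- k * \<bar>y\<bar>))" using integrable_exp_abs[OF k] by simp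
    have "continuous_on UNIV (\<lambda>y. g (Complex x y))"
      by (rule continuous_on_compose2[OF holomorphic_on_imp_continuous_on[OF hol]])
         (use x lu in \<open>auto simp: Complex_eq intro!: continuous_intros\<close>)
    then show "(\<lambda>y. g (Complex x y)) \<in> borel_measurable lborel" 
      by (simp add: borel_measurable_continuous_onI)
    show "AE y in lborel. norm (g (Complex x y)) \<le> norm (B * exp (- k * \<bar>y\<bar>))"
      using bound[OF x] by (auto intro!: AE_I2 order_trans[OF _ abs_ge_self])
  qed
  have ftc: "(LINT y:{-R..R}|lborel. g (Complex x y))
      = - \<i> * (G (Complex x R) - G (Complex x (- R)))"
    if x: "c \<le> x" "x \<le> c'" and R: "R \<ge> 0" for x R
  proof -
    have der: "((\<lambda>y. - \<i> * G (Complex x y))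
        has_vector_derivative g (Complex x y)) (at y within {-R..R})" for y
    proof -
      have "((\<lambda>y. Complex x y) has_vector_derivative \<i>) (at y within {-R..R})"
        unfolding Complex_eq by (auto intro!: derivative_eq_intros)
      then have "((\<lambda>y. G (Complex x y)) has_vector_derivative (\<i> * g (Complex x y)))
          (at y within {-R..R})"
        using field_vector_diff_chain_within[of "\<lambda>y. Complex x y" \<i> y "{-R..R}" G "g (Complex x y)"]
          has_field_derivative_at_within[OF G'[of "Complex x y"]] x lu by (simp add: o_def)
      from has_vector_derivative_mult_right[OF this, of "- \<i>"] show ?thesis
        by (simp add: algebra_simps)
    qed
    have "((\<lambda>y. g (Complex x y)) has_integral (- \<i> * G (Complex x R))
        - (- \<i> * G (Complex x (- R)))) {-R..R}"
      by (rule fundamental_theorem_of_calculus) (use R der in auto)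
    moreover have "set_integrable lborel {-R..R} (\<lambda>y. g (Complex x y))"
      unfolding set_integrable_def using int[OF x] by (intro integrable_mult_indicator) auto
    ultimately show ?thesis
      by (simp add: set_borel_integral_eq_integral integral_unique algebra_simps)
  qed
  have side: "cmod (G (Complex c y) - G (Complex c' y))
      \<le> (B * exp (- k * \<bar>y\<bar>)) * cmod (Complex c y - Complex c' y)" for y
  proof (rule field_differentiable_bound[of "closed_segment (Complex c y) (Complex c' y)"])
    fix z assume "z \<in> closed_segment (Complex c y) (Complex c' y)"
    then have z: "Im z = y" "c \<le> Re z" "Re z \<le> c'"
      using lu by (auto simp: closed_segment_same_Im closed_segment_eq_real_ivl)
    then have "Complex (Re z) y = z" by (simp add: complex_eq_iff)
    with bound[OF z(2,3), of y] show "cmod (g z) \<le> B * exp (- k * \<bar>y\<bar>)" by simp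
    show "(G has_field_derivative g z) (at z within closed_segment (Complex c y) (Complex c' y))"
      by (rule has_field_derivative_at_within[OF G']) (use z lu in auto)
  qed auto
  have lim: "((\<lambda>R. LINT y:{-R..R}|lborel. g (Complex x y))
      \<longlongrightarrow> (LINT y|lborel. g (Complex x y))) at_top"
    if x: "c \<le> x" "x \<le> c'" for x
    unfolding set_lebesgue_integral_def
  proof (rule integral_dominated_convergence_at_top)
    show "integrable lborel (\<lambda>y. cmod (g (Complex x y)))" using int[OF x] by simp
    show "AE y in lborel. ((\<lambda>R. indicator {-R..R} y *\<^sub>R g (Complex x y)) \<longlongrightarrow> g (Complex x y)) at_top"
    proof (rule AE_I2, rule tendsto_eventually)
      fix y :: real
      show "\<forall>\<^sub>F R in at_top. indicator {-R..R} y *\<^sub>R g (Complex x y) = g (Complex x y)"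
        using eventually_ge_at_top[of "\<bar>y\<bar>"] by eventually_elim (auto simp: indicator_def)
    qed
  qed (use borel_measurable_integrable[OF int[OF x]] in \<open>auto intro!: AE_I2 always_eventually simp: indicator_def\<close>)
  have zero: "((\<lambda>R. (LINT y:{-R..R}|lborel. g (Complex c y))
      - (LINT y:{-R..R}|lborel. g (Complex c' y))) \<longlongrightarrow> 0) at_top"
  proof (rule Lim_null_comparison)
    show "\<forall>\<^sub>F R in at_top. cmod ((LINT y:{-R..R}|lborel. g (Complex c y))
        - (LINT y:{-R..R}|lborel. g (Complex c' y)))
        \<le> 2 * (B * exp (- k * R) * (c' - c))"
      using eventually_ge_at_top[of 0]
    proof eventually_elim
      case (elim R)
      have "(LINT y:{-R..R}|lborel. g (Complex c y)) - (LINT y:{-R..R}|lborel. g (Complex c' y))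
          = - \<i> * ((G (Complex c R) - G (Complex c' R))
              - (G (Complex c (-R)) - G (Complex c' (-R))))"
        using lu elim by (simp add: ftc algebra_simps)
      also have "cmod \<dots> \<le> cmod (G (Complex c R) - G (Complex c' R))
          + cmod (G (Complex c (-R)) - G (Complex c' (-R)))"
        by (simp only: norm_mult norm_minus_cancel norm_ii mult_1) (rule norm_triangle_ineq4)
      also have "\<dots> \<le> 2 * (B * exp (- k * R) * (c' - c))"
        using side[of R] side[of "-R"] lu elim by (simp add: cmod_def)
      finally show ?case .
    qed
    show "((\<lambda>R. 2 * (B * exp (- k * R) * (c' - c))) \<longlongrightarrow> 0) at_top"
      using k by real_asymp
  qed
  have diff: "((\<lambda>R. (LINT y:{-R..R}|lborel. g (Complex c y))
      - (LINT y:{-R..R}|lborel. g (Complex c' y)))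
      \<longlongrightarrow> (LINT y|lborel. g (Complex c y)) - (LINT y|lborel. g (Complex c' y))) at_top"
    using lu by (intro tendsto_diff lim) auto
  show ?thesis
    using tendsto_unique[OF trivial_limit_at_top_linorder diff zero] by (simp only: right_minus_eq)
qed

section \<open>The double sine function\<close>

text \<open>The factor of the integrand in the definition of \<open>S_fun\<close> that does not depend on \<open>z\<close>. It is odd
  and has a pole of order three at the origin.\<close>

definition S_kernel :: "real \<Rightarrow> complex \<Rightarrow> complex" where
  "S_kernel b t = 1 / (4 * t * sinh (of_real b * t / 2) * sinh (t / (2 * of_real b)))"

lemma S_kernel_minus: "S_kernel b (- t) = - S_kernel b t"
  by (simp add: S_kernel_def)

lemma sinh_nonzero_complex:
  assumes "z \<noteq> 0" "cmod z < pi"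
  shows "sinh z \<noteq> 0"
proof
  assume "sinh z = 0"
  then obtain n :: int where n: "\<i> * z = of_real (of_int n * pi)"
    by (auto simp: sinh_conv_sin sin_eq_0)
  have "cmod z = cmod (\<i> * z)" by (simp add: norm_mult)
  also have "\<dots> = \<bar>of_int n\<bar> * pi" unfolding n norm_of_real by (simp add: abs_mult)
  finally have "cmod z = \<bar>of_int n\<bar> * pi" .
  with assms have "\<bar>of_int n\<bar> * pi < 1 * pi" by simp
  then have "\<bar>real_of_int n\<bar> < 1" by (simp only: mult_less_cancel_right_pos[OF pi_gt_zero])
  then have "n = 0" by linarith
  with n assms show False by simp
qed

lemma sinh_real_lower:
  assumes "x0 \<le> (x::real)"
  shows "(1 - exp (- 2 * x0)) / 2 * exp x \<le> sinh x"
proof -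
  have "exp (- x) = exp (- 2 * x) * exp x" by (simp add: mult_exp_exp)
  also have "\<dots> \<le> exp (- 2 * x0) * exp x" using assms by simp
  finally have "exp (- x) \<le> exp (- 2 * x0) * exp x" .
  then have "(exp x - exp (- 2 * x0) * exp x) / 2 \<le> sinh x" unfolding sinh_field_def by simp
  moreover have "(1 - exp (- 2 * x0)) / 2 * exp x = (exp x - exp (- 2 * x0) * exp x) / 2"
    by (simp add: left_diff_distrib)
  ultimately show ?thesis by (simp only:)
qed

lemma S_kernel_real_bound:
  assumes "b > 0"
  obtains C where "C \<ge> 0" "\<And>t. pi * b \<le> t \<Longrightarrow>
      cmod (S_kernel b (of_real t)) \<le> C * exp (- (Q b / 2) * t)"
proof -
  define s1 s2 where "s1 = (1 - exp (- 2 * (pi * b * b / 2))) / 2"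
    and "s2 = (1 - exp (- 2 * (pi / 2))) / 2"
  have s: "s1 > 0" "s2 > 0" using assms by (auto simp: s1_def s2_def)
  define C where "C = 1 / (4 * (pi * b) * s1 * s2)"
  show ?thesis
  proof (rule that)
    show "C \<ge> 0" using assms s by (simp add: C_def)
    fix t assume t: "pi * b \<le> t"
    have t0: "t > 0" using assms t mult_pos_pos[OF pi_gt_zero assms] by linarith
    have "pi * b * b / 2 \<le> b * t / 2" using mult_right_mono[OF t, of b] assms
      by (simp add: mult.commute)
    from sinh_real_lower[OF this] have 1: "s1 * exp (b * t / 2) \<le> sinh (b * t / 2)"
      by (simp add: s1_def)
    have "pi / 2 \<le> t / (2 * b)" using t assms by (simp add: field_simps)
    from sinh_real_lower[OF this] have 2: "s2 * exp (t / (2 * b)) \<le> sinh (t / (2 * b))"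
      by (simp add: s2_def)
    have "(4 * (pi * b) * s1 * s2) * exp (Q b / 2 * t)
        = 4 * (pi * b) * (s1 * exp (b * t / 2)) * (s2 * exp (t / (2 * b)))"
    proof -
      have "Q b / 2 * t = b * t / 2 + t / (2 * b)" by (simp add: Q_def field_simps)
      then have "exp (Q b / 2 * t) = exp (b * t / 2) * exp (t / (2 * b))" by (simp only: exp_add)
      then show ?thesis by simp
    qed
    also have "\<dots> \<le> 4 * t * sinh (b * t / 2) * sinh (t / (2 * b))"
      using assms t s t0 1 2 by (intro mult_mono) auto
    finally have le: "(4 * (pi * b) * s1 * s2) * exp (Q b / 2 * t)
        \<le> 4 * t * sinh (b * t / 2) * sinh (t / (2 * b))" .
    have sinh_of_real: "sinh (of_real x) = (of_real (sinh x) :: complex)" for x :: real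
      by (simp add: sinh_field_def flip: exp_of_real)
    have eq: "S_kernel b (of_real t)
        = of_real (1 / (4 * t * sinh (b * t / 2) * sinh (t / (2 * b))))"
      by (simp add: S_kernel_def sinh_of_real[symmetric])
    have pos: "0 < (4 * (pi * b) * s1 * s2) * exp (Q b / 2 * t)" using s assms by simp
    have "cmod (S_kernel b (of_real t)) = 1 / (4 * t * sinh (b * t / 2) * sinh (t / (2 * b)))"
      unfolding eq norm_of_real using le pos by (intro abs_of_nonneg divide_nonneg_nonneg) linarith+
    also have "\<dots> \<le> 1 / ((4 * (pi * b) * s1 * s2) * exp (Q b / 2 * t))"
      by (rule frac_le[OF _ _ pos le]) auto
    also have "\<dots> = C * exp (- (Q b / 2) * t)"
      by (simp add: C_def exp_minus field_simps)
    finally show "cmod (S_kernel b (of_real t)) \<le> C * exp (- (Q b / 2) * t)" .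
  qed
qed

lemma S_kernel_denominator_nonzero:
  assumes "0 < b" "b < 1" "t \<noteq> 0" "cmod t < 2 * pi * b"
  shows "4 * t * sinh (of_real b * t / 2) * sinh (t / (2 * of_real b)) \<noteq> 0"
proof -
  have "cmod (of_real b * t / 2) < pi"
  proof -
    have "b * cmod t < 1 * (2 * pi * b)" using assms by (intro mult_strict_mono) auto
    also have "\<dots> < 2 * pi" using assms by simp
    finally show ?thesis using assms by (simp add: norm_mult norm_divide)
  qed
  moreover have "cmod (t / (2 * of_real b)) < pi"
    using assms by (simp add: norm_mult norm_divide field_simps)
  ultimately show ?thesis
    using assms sinh_nonzero_complex[of "of_real b * t / 2"] sinh_nonzero_complex[of "t
        / (2 * of_real b)"]
    by simp
qed

lemma sinh_holomorphic [holomorphic_intros]: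
  assumes "f holomorphic_on S" shows "(\<lambda>z. sinh (f z) :: complex) holomorphic_on S"
  unfolding sinh_field_def using assms by (intro holomorphic_intros) auto

lemma S_kernel_holomorphic:
  assumes "0 < b" "b < 1"
  shows "S_kernel b holomorphic_on (ball 0 (2 * pi * b) - {0})"
  unfolding S_kernel_def
  using S_kernel_denominator_nonzero[OF assms] assms by (intro holomorphic_intros) auto

text \<open>The residue of \<open>exp (v * t) * S_kernel b t\<close> at the origin is \<open>(v\<^sup>2 + h) / 2\<close>, where \<open>h\<close> does not
  depend on \<open>v\<close>. A term linear in \<open>v\<close> is absent because \<open>t ^ 3 * S_kernel b t\<close> is even.\<close>

lemma S_kernel_residue_circle:
  assumes b: "0 < b" "b < 1"
  obtains h where "\<And>v. ((\<lambda>t. exp (v * t) * S_kernel b t)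
      has_contour_integral (pi * \<i> * (v\<^sup>2 + h))) (circlepath 0 (pi * b))"
proof -
  \<comment> \<open>the regular factor \<open>t ^ 3 * S_kernel b t\<close>, extended over its removable singularity\<close>
  define H where "H = (\<lambda>t. if t = 0 then 1 else t ^ 3 * S_kernel b t)"
  let ?B = "ball (0::complex) (2 * pi * b)"
  have lim: "((\<lambda>t. sinh (a * t) / t) \<longlongrightarrow> a) (at 0)" for a :: complex
  proof -
    have "((\<lambda>t. sinh (a * t)) has_field_derivative a) (at 0)"
      unfolding sinh_field_def by (auto intro!: derivative_eq_intros)
    then show ?thesis by (simp add: has_field_derivative_iff)
  qed
  have holH: "H holomorphic_on ?B"
  proof (rule no_isolated_singularity'[where K="{0}"])
    fix z :: complex assume "z \<in> {0}"
    define a1 a2 where "a1 = of_real b / (2::complex)" and "a2 = 1 / (2 * of_real b :: complex)"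
    have "((\<lambda>t. 1 / (4 * (sinh (a1 * t) / t) * (sinh (a2 * t) / t))) \<longlongrightarrow> 1 / (4 * a1 * a2)) (at 0)"
      using b by (intro tendsto_intros lim) (auto simp: a1_def a2_def)
    moreover have "1 / (4 * a1 * a2) = 1" using b by (simp add: a1_def a2_def)
    ultimately have "((\<lambda>t. 1 / (4 * (sinh (a1 * t) / t) * (sinh (a2 * t) / t))) \<longlongrightarrow> 1) (at 0)" by simp
    moreover have "\<forall>\<^sub>F t in at 0. 1 / (4 * (sinh (a1 * t) / t) * (sinh (a2 * t) / t)) = H t"
      unfolding eventually_at_filter
      by (auto simp: H_def S_kernel_def a1_def a2_def power3_eq_cube field_simps)
    ultimately have "(H \<longlongrightarrow> 1) (at 0)" by (rule Lim_transform_eventually)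
    then show "(H \<longlongrightarrow> H z) (at z within ?B)" using \<open>z \<in> {0}\<close> 
      by (auto simp: H_def intro: tendsto_within_subset)
  next
    have "(\<lambda>t. t ^ 3 * S_kernel b t) holomorphic_on ?B - {0}"
      using S_kernel_holomorphic[OF b] by (intro holomorphic_intros)
    then show "H holomorphic_on ?B - {0}"
      by (rule holomorphic_transform) (auto simp: H_def)
  qed auto
  have H0: "H 0 = 1" by (simp add: H_def)
  have dH: "(H has_field_derivative deriv H 0) (at 0)"
    using holH b by (intro holomorphic_derivI[of _ ?B]) auto
  have H1: "deriv H 0 = 0"
  proof -
    have "((\<lambda>t. H (- t)) has_field_derivative deriv H 0 * (- 1)) (at 0)"
      by (rule DERIV_chain2[of H]) (use dH in \<open>auto intro!: derivative_eq_intros\<close>)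
    moreover have "(\<lambda>t. H (- t)) = H" by (auto simp: H_def S_kernel_minus)
    ultimately have "deriv H 0 * (- 1) = deriv H 0" using dH DERIV_unique[of H] by simp
    then show ?thesis by simp
  qed
  show ?thesis
  proof (rule that)
    fix v :: complex
    let ?E = "\<lambda>t. exp (v * t)"
    have lt: "pi * b < 2 * pi * b" using b by simp
    have sub: "cball 0 (pi * b) \<subseteq> ?B"
    proof
      fix x :: complex assume "x \<in> cball 0 (pi * b)"
      then have "cmod x \<le> pi * b" by simp
      from order.strict_trans1[OF this lt] show "x \<in> ?B" by simp
    qed
    have holE: "?E holomorphic_on ?B" by (intro holomorphic_intros)
    have hol: "(\<lambda>t. ?E t * H t) holomorphic_on ?B" by (intro holomorphic_on_mult holE holH)
    have dE: "deriv ?E = (\<lambda>t. v * exp (v * t))"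
      by (rule ext, rule DERIV_imp_deriv) (auto intro!: derivative_eq_intros)
    have ddE: "deriv (\<lambda>t. v * exp (v * t)) = (\<lambda>t. v * v * exp (v * t))"
      by (rule ext, rule DERIV_imp_deriv) (auto intro!: derivative_eq_intros)
    have "(deriv ^^ 2) (\<lambda>t. ?E t * H t) 0
        = (\<Sum>i = 0..2. of_nat (2 choose i) * (deriv ^^ i) ?E 0 * (deriv ^^ (2 - i)) H 0)"
      by (rule higher_deriv_mult[OF holE holH]) (use b in auto)
    also have "\<dots> = v\<^sup>2 + (deriv ^^ 2) H 0"
      by (simp add: numeral_2_eq_2 dE ddE H0 H1)
    finally have D: "(deriv ^^ 2) (\<lambda>t. ?E t * H t) 0 = v\<^sup>2 + (deriv ^^ 2) H 0" .
    have "((\<lambda>t. (?E t * H t) / (t - 0) ^ Suc 2) has_contour_integral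
        (2 * pi * \<i>) / fact 2 * (deriv ^^ 2) (\<lambda>t. ?E t * H t) 0) (circlepath 0 (pi * b))"
      by (rule Cauchy_has_contour_integral_higher_derivative_circlepath)
         (use b sub hol in \<open>auto intro: holomorphic_on_imp_continuous_on holomorphic_on_subset
            simp: holomorphic_on_subset[OF hol subset_trans[OF ball_subset_cball sub]]\<close>)
    then have "((\<lambda>t. (?E t * H t) / (t - 0) ^ Suc 2) has_contour_integral
        pi * \<i> * (v\<^sup>2 + (deriv ^^ 2) H 0)) (circlepath 0 (pi * b))"
      unfolding D by (simp add: field_simps)
    then show "((\<lambda>t. ?E t * S_kernel b t) has_contour_integral
        pi * \<i> * (v\<^sup>2 + (deriv ^^ 2) H 0)) (circlepath 0 (pi * b))"
    proof (rule has_contour_integral_eq)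
      fix t assume "t \<in> path_image (circlepath 0 (pi * b))"
      then have "t \<noteq> 0" using b by auto
      then show "?E t * H t / (t - 0) ^ Suc 2 = ?E t * S_kernel b t"
        by (simp add: H_def eval_nat_numeral)
    qed
  qed
qed

text \<open>The lower half circle is folded onto the upper one by \<open>t \<mapsto> - t\<close>.\<close>

lemma circlepath_as_half_circle:
  assumes "continuous_on (sphere 0 r) F" "r > 0"
  shows "contour_integral (circlepath 0 r) F =
    - contour_integral (part_circlepath 0 r pi 0) F
        + contour_integral (part_circlepath 0 r pi 0) (\<lambda>t. F (- t))"
proof -
  let ?g = "\<lambda>\<theta>. F (0 + r * cis \<theta>) * r * \<i> * cis \<theta>"
  have cont: "continuous_on S ?g" for S
    by (rule continuous_on_subset[of UNIV])
       (use assms in \<open>auto intro!: continuous_intros continuous_on_compose2[OF assms(1)] simp: norm_mult\<close>)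
  have full: "contour_integral (circlepath 0 r) F = integral {0..2*pi} ?g"
    unfolding circlepath_def by (rule contour_integral_part_circlepath_eq) simp
  have up: "contour_integral (part_circlepath 0 r pi 0) F = - integral {0..pi} ?g"
    by (subst contour_integral_part_circlepath_reverse, subst contour_integral_part_circlepath_eq) auto
  have up': "contour_integral (part_circlepath 0 r pi 0) (\<lambda>t. F (- t)) 
      = - integral {0..pi} (\<lambda>\<theta>. F (- (0 + r * cis \<theta>)) * r * \<i> * cis \<theta>)"
    by (subst contour_integral_part_circlepath_reverse, subst contour_integral_part_circlepath_eq) auto
  have "integral {0..2*pi} ?g = integral {0..pi} ?g + integral {pi..2*pi} ?g"
    by (rule Henstock_Kurzweil_Integration.integral_combine[symmetric])
      (simp, simp, intro integrable_continuous_real cont)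
  also have "integral {pi..2*pi} ?g = integral {0..pi} (?g \<circ> (+) pi)"
    using integral_shift_Icc_real[of 0 pi ?g pi] by (simp add: add_ac)
  also have "?g \<circ> (+) pi = (\<lambda>\<theta>. - (F (- (0 + r * cis \<theta>)) * r * \<i> * cis \<theta>))"
  proof (rule ext)
    fix \<theta> have "cis (pi + \<theta>) = - cis \<theta>" by (simp add: cis_mult[symmetric])
    then show "(?g \<circ> (+) pi) \<theta> = - (F (- (0 + r * cis \<theta>)) * r * \<i> * cis \<theta>)" by simp
  qed
  finally show ?thesis unfolding full up up' by simp
qed

lemma S_kernel_measurable: "(\<lambda>t::real. S_kernel b (of_real t)) \<in> borel_measurable borel"
  unfolding S_kernel_def sinh_field_def by measurable

text \<open>The exponential constituent of \<open>log (S_fun b z)\<close>: that logarithm is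
  \<open>(S_transform b v - S_transform b (- v)) / 2\<close> at \<open>v = Q b / 2 - z\<close> (see \<open>S_fun_eq\<close>). The two
  abbreviations are the contributions of the right half line and of the half circle to the
  contour.\<close>

definition S_transform :: "real \<Rightarrow> complex \<Rightarrow> complex" where
  "S_transform b v = \<Omega>_integral b (\<lambda>t. exp (v * t) * S_kernel b t)"

abbreviation half_line_part :: "real \<Rightarrow> complex \<Rightarrow> complex" where
  "half_line_part b v \<equiv> (LINT t:{pi * b..}|lborel. exp (v * of_real t) * S_kernel b (of_real t))"

abbreviation half_circle_part :: "real \<Rightarrow> complex \<Rightarrow> complex" where
  "half_circle_part b v \<equiv> contour_integral (part_circlepath 0 (pi * b) pi 0)
      (\<lambda>t. exp (v * t) * S_kernel b t)"

lemma half_line_dominated: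
  assumes b: "b > 0" and R: "R < Q b / 2"
  obtains g where "integrable lborel g"
    "\<And>v t. Re v \<le> R \<Longrightarrow>
       cmod (indicator {pi * b..} t *\<^sub>R (exp (v * of_real t) * S_kernel b (of_real t))) \<le> g t"
proof -
  obtain C where C: "C \<ge> 0"
    "\<And>t. pi * b \<le> t \<Longrightarrow> cmod (S_kernel b (of_real t)) \<le> C * exp (- (Q b / 2) * t)"
    using S_kernel_real_bound[OF b] by blast
  show ?thesis
  proof (rule that)
    show "integrable lborel (\<lambda>t. C * exp (- (Q b / 2 - R) * \<bar>t\<bar>))"
      using integrable_exp_abs[of "Q b / 2 - R"] R by (intro integrable_mult_right) simp
    fix v :: complex and t :: real assume v: "Re v \<le> R"
    show "cmod (indicator {pi * b..} t *\<^sub>R (exp (v * of_real t) * S_kernel b (of_real t)))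
        \<le> C * exp (- (Q b / 2 - R) * \<bar>t\<bar>)"
    proof (cases "pi * b \<le> t")
      case True
      have t: "t > 0" using True b mult_pos_pos[OF pi_gt_zero b] by linarith
      have "cmod (exp (v * of_real t) * S_kernel b (of_real t))
          \<le> exp (R * t) * (C * exp (- (Q b / 2) * t))"
        unfolding norm_mult using t v C True by (intro mult_mono) auto
      also have "\<dots> = C * exp (- (Q b / 2 - R) * \<bar>t\<bar>)"
        using t by (simp add: algebra_simps exp_add[symmetric])
      finally show ?thesis using True by simp
    qed (use C in auto)
  qed
qed

lemma half_line_integrable:
  assumes "b > 0" "Re v < Q b / 2"
  shows "set_integrable lborel {pi * b..} (\<lambda>t. exp (v * of_real t) * S_kernel b (of_real t))"
proof -
  obtain g where g: "integrable lborel g" "\<And>w t. Re w \<le> Re v \<Longrightarrow>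
       cmod (indicator {pi * b..} t *\<^sub>R (exp (w * of_real t) * S_kernel b (of_real t))) \<le> g t"
    by (rule half_line_dominated[OF assms]) blast
  show ?thesis
    unfolding set_integrable_def
  proof (rule Bochner_Integration.integrable_bound[OF g(1)])
    show "(\<lambda>t. indicat_real {pi * b..} t *\<^sub>R (exp (v * of_real t) * S_kernel b (of_real t)))
        \<in> borel_measurable lborel"
      using S_kernel_measurable by measurable
    show "AE t in lborel. cmod (indicat_real {pi * b..} t *\<^sub>R
        (exp (v * of_real t) * S_kernel b (of_real t))) \<le> norm (g t)"
      using g(2)[OF order_refl] by (auto intro!: AE_I2 order_trans[OF _ abs_ge_self])
  qed
qed

lemma half_line_left:
  "(LINT t:{..- (pi * b)}|lborel. exp (v * of_real t) * S_kernel b (of_real t))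
      = - half_line_part b (- v)"
proof -
  have "(LINT t:{..- (pi * b)}|lborel. exp (v * of_real t) * S_kernel b (of_real t))
      = (LINT t:{pi * b..}|lborel. - (exp (- v * of_real t) * S_kernel b (of_real t)))"
    by (subst set_integral_reflect) (simp add: S_kernel_minus atLeast_def le_minus_iff)
  also have "\<dots> = - half_line_part b (- v)"
    by (simp add: set_lebesgue_integral_def)
  finally show ?thesis .
qed

lemma S_transform_decompose:
  "S_transform b v = half_line_part b v - half_line_part b (- v) + half_circle_part b v"
  unfolding S_transform_def \<Omega>_integral_def half_line_left by simp

lemma S_kernel_continuous_circle:
  assumes "0 < b" "b < 1" shows "continuous_on (sphere 0 (pi * b)) (S_kernel b)"
  by (rule continuous_on_subset[OF holomorphic_on_imp_continuous_on[OF S_kernel_holomorphic[OF assms]]])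
     (use assms in auto)

lemma half_circle_integrable:
  assumes "0 < b" "b < 1"
  shows "(\<lambda>t. exp (v * t) * S_kernel b t) contour_integrable_on (part_circlepath 0 (pi * b) pi 0)"
proof (rule contour_integrable_continuous_part_circlepath)
  have "path_image (part_circlepath 0 (pi * b) pi 0) \<subseteq> sphere 0 (pi * b)"
    using path_image_part_circlepath_subset'[of "pi * b" 0 pi 0] assms by simp
  then show "continuous_on (path_image (part_circlepath 0 (pi * b) pi 0))
      (\<lambda>t. exp (v * t) * S_kernel b t)"
    by (intro continuous_intros continuous_on_subset[OF S_kernel_continuous_circle[OF assms]])
qed

text \<open>The half lines cancel in the sum of the transforms at \<open>v\<close> and \<open>- v\<close>, and the half circles close
  up to a full circle, traversed clockwise, so that only the residue at the origin remains.\<close>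

lemma S_transform_add_minus:
  assumes b: "0 < b" "b < 1"
  obtains h where "\<And>v. S_transform b v + S_transform b (- v) = - (pi * \<i> * (v\<^sup>2 + h))"
proof -
  obtain h where h: "\<And>v. ((\<lambda>t. exp (v * t) * S_kernel b t)
      has_contour_integral (pi * \<i> * (v\<^sup>2 + h))) (circlepath 0 (pi * b))"
    using S_kernel_residue_circle[OF b] by blast
  show ?thesis
  proof (rule that)
    fix v
    have "continuous_on (sphere 0 (pi * b)) (\<lambda>t. exp (v * t) * S_kernel b t)"
      by (intro continuous_intros S_kernel_continuous_circle b)
    from circlepath_as_half_circle[OF this] b
    have "pi * \<i> * (v\<^sup>2 + h) = - half_circle_part b v + 
        contour_integral (part_circlepath 0 (pi * b) pi 0) (\<lambda>t. - (exp (- v * t) * S_kernel b t))"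
      by (simp add: contour_integral_unique[OF h] S_kernel_minus)
    also have "contour_integral (part_circlepath 0 (pi * b) pi 0)
        (\<lambda>t. - (exp (- v * t) * S_kernel b t))
        = - half_circle_part b (- v)"
      by (rule contour_integral_neg)
    finally show "S_transform b v + S_transform b (- v) = - (pi * \<i> * (v\<^sup>2 + h))"
      unfolding S_transform_decompose by simp
  qed
qed

text \<open>On the upper half circle \<open>exp (v * t)\<close> stays bounded as long as \<open>Im v \<ge> 0\<close>.\<close>

lemma S_transform_bounded:
  assumes b: "0 < b" "b < 1" and R: "R < Q b / 2"
  obtains B where "\<And>v. \<bar>Re v\<bar> \<le> R \<Longrightarrow> 0 \<le> Im v \<Longrightarrow> cmod (S_transform b v) \<le> B"
proof -
  obtain g where g: "integrable lborel g" "\<And>v t. Re v \<le> R \<Longrightarrow>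
       cmod (indicator {pi * b..} t *\<^sub>R (exp (v * of_real t) * S_kernel b (of_real t))) \<le> g t"
    by (rule half_line_dominated[OF b(1) R]) blast
  have line: "cmod (half_line_part b v) \<le> integral\<^sup>L lborel g" if "Re v \<le> R" for v
    unfolding set_lebesgue_integral_def
      by (rule Bochner_Integration.integral_norm_bound_integral)
      (use half_line_integrable[OF b(1), of v] g that R in \<open>auto simp: set_integrable_def\<close>)
  obtain K where K: "\<And>t. t \<in> sphere 0 (pi * b) \<Longrightarrow> cmod (S_kernel b t) \<le> K"
    using compact_imp_bounded[OF compact_continuous_image[OF S_kernel_continuous_circle[OF b] compact_sphere]]
    unfolding bounded_iff by blast
  have "of_real (pi * b) \<in> sphere (0::complex) (pi * b)" using b by (simp add: norm_mult)
  from K[OF this] have K0: "0 \<le> K" by (rule order_trans[OF norm_ge_zero])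
  define D where "D = exp (R * (pi * b)) * K * (pi * b) * \<bar>0 - pi\<bar>"
  have circ: "cmod (half_circle_part b v) \<le> D" if v: "\<bar>Re v\<bar> \<le> R" "0 \<le> Im v" for v
    unfolding D_def
  proof (rule contour_integral_bound_part_circlepath)
    show "(\<lambda>t. exp (v * t) * S_kernel b t) contour_integrable_on (part_circlepath 0 (pi * b) pi 0)"
      by (rule half_circle_integrable[OF b])
    fix t assume "t \<in> path_image (part_circlepath 0 (pi * b) pi 0)"
    then have "t \<in> path_image (part_circlepath 0 (pi * b) 0 pi)"
      by (metis path_image_reversepath reversepath_part_circlepath)
    then obtain \<theta> where th: "0 \<le> \<theta>" "\<theta> \<le> pi" "t = of_real (pi * b) * exp (\<i> * \<theta>)"
      by (subst (asm) path_image_part_circlepath) auto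
    have nt: "cmod t = pi * b" unfolding th(3) using b by (simp add: norm_mult)
    have "Im t = pi * b * sin \<theta>" unfolding th(3) by (simp add: Im_exp)
    then have It: "Im t \<ge> 0" using th b sin_ge_zero[of \<theta>] by simp
    have "Re v * Re t \<le> \<bar>Re v\<bar> * \<bar>Re t\<bar>" by (metis abs_ge_self abs_mult)
    also have "\<dots> \<le> R * (pi * b)" using v abs_Re_le_cmod[of t] nt by (intro mult_mono) auto
    finally have "Re v * Re t \<le> R * (pi * b)" .
    moreover have "0 \<le> Im v * Im t" using It v by (intro mult_nonneg_nonneg)
    ultimately have "Re (v * t) \<le> R * (pi * b)" unfolding times_complex.simps by linarith
    then show "cmod (exp (v * t) * S_kernel b t) \<le> exp (R * (pi * b)) * K"
      unfolding norm_mult using K[of t] nt K0 by (intro mult_mono) auto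
  qed (use K0 b in auto)
  show ?thesis
  proof (rule that)
    fix v assume v: "\<bar>Re v\<bar> \<le> R" "0 \<le> Im v"
    have "cmod (S_transform b v) \<le> cmod (half_line_part b v) + cmod (half_line_part b (- v))
        + cmod (half_circle_part b v)"
      unfolding S_transform_decompose
        by (meson add_mono norm_triangle_ineq norm_triangle_ineq4 order_trans order_refl)
    also have "\<dots> \<le> integral\<^sup>L lborel g + integral\<^sup>L lborel g + D"
      using v by (intro add_mono line circ) auto
    finally show "cmod (S_transform b v) \<le> integral\<^sup>L lborel g + integral\<^sup>L lborel g + D" .
  qed
qed

lemma \<Omega>_integral_sinh:
  assumes b: "0 < b" "b < 1" and w: "\<bar>Re w\<bar> < Q b / 2"
  shows "\<Omega>_integral b (\<lambda>t. sinh (w * t) * S_kernel b t)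
      = (S_transform b w - S_transform b (- w)) / 2"
proof -
  have sh: "sinh (w * t) * S_kernel b t
      = (exp (w * t) * S_kernel b t - exp (- w * t) * S_kernel b t) / 2" for t
    by (simp add: sinh_field_def algebra_simps diff_divide_distrib)
  have right: "(LINT t:{pi * b..}|lborel. sinh (w * of_real t) * S_kernel b (of_real t))
     = (half_line_part b w - half_line_part b (- w)) / 2"
    unfolding sh using half_line_integrable[OF b(1), of w] half_line_integrable[OF b(1), of "- w"] w
    by (simp add: set_integral_diff)
  have "(LINT t:{..-(pi * b)}|lborel. sinh (w * of_real t) * S_kernel b (of_real t))
     = (LINT t:{pi * b..}|lborel. sinh (w * of_real t) * S_kernel b (of_real t))"
    by (subst set_integral_reflect) (simp add: S_kernel_minus atLeast_def le_minus_iff)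
  then have left: "(LINT t:{..-(pi * b)}|lborel. sinh (w * of_real t) * S_kernel b (of_real t))
     = (half_line_part b w - half_line_part b (- w)) / 2" unfolding right .
  have circ: "contour_integral (part_circlepath 0 (pi * b) pi 0) (\<lambda>t. sinh (w * t) * S_kernel b t)
     = (half_circle_part b w - half_circle_part b (- w)) / 2"
    unfolding sh
    by (rule contour_integral_unique)
       (intro has_contour_integral_div has_contour_integral_diff has_contour_integral_integral half_circle_integrable b)
  show ?thesis
    unfolding \<Omega>_integral_def S_transform_decompose left right circ minus_minus
    by (simp only: add_divide_distrib diff_divide_distrib) (simp add: field_simps)
qed

lemma S_fun_eq:
  assumes b: "0 < b" "b < 1" and z: "0 < Re z" "Re z < Q b"
  shows "S_fun b z = exp ((S_transform b (of_real (Q b) / 2 - z)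
      - S_transform b (- (of_real (Q b) / 2 - z))) / 2)"
proof -
  have "Re (of_real (Q b) / 2 - z) = Q b / 2 - Re z" by simp
  then have "\<bar>Re (of_real (Q b) / 2 - z)\<bar> < Q b / 2"
    using z by (simp only: abs_less_iff) linarith
  from \<Omega>_integral_sinh[OF b this]
  have "exp (\<Omega>_integral b (\<lambda>t. sinh ((of_real (Q b) / 2 - z) * t) * S_kernel b t))
      = exp ((S_transform b (of_real (Q b) / 2 - z) - S_transform b (- (of_real (Q b) / 2 - z)))
          / 2)"
    by (simp only:)
  then show ?thesis
    by (simp add: S_fun_def S_kernel_def)
qed

lemma S_transform_holomorphic:
  assumes b: "0 < b" "b < 1"
  shows "S_transform b holomorphic_on {v. \<bar>Re v\<bar> < Q b / 2}"
proof -
  let ?S = "{v. \<bar>Re v\<bar> < Q b / 2}"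
  have line: "(\<lambda>v. half_line_part b v) holomorphic_on ?S"
    unfolding set_lebesgue_integral_def
  proof (rule holomorphic_on_lebesgue_integral)
    fix v assume v: "v \<in> ?S"
    show "(\<lambda>t. indicat_real {pi * b..} t *\<^sub>R (exp (v * of_real t) * S_kernel b (of_real t)))
        \<in> borel_measurable lborel"
      using S_kernel_measurable by measurable
    define r where "r = (Q b / 2 - \<bar>Re v\<bar>) / 2"
    have r: "r > 0" "\<bar>Re v\<bar> + r < Q b / 2" using v by (auto simp: r_def field_simps)
    obtain g where g: "integrable lborel g" "\<And>w t. Re w \<le> \<bar>Re v\<bar> + r \<Longrightarrow>
       cmod (indicator {pi * b..} t *\<^sub>R (exp (w * of_real t) * S_kernel b (of_real t))) \<le> g t"
      by (rule half_line_dominated[OF b(1) r(2)]) blast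
    have Re: "\<bar>Re w\<bar> \<le> \<bar>Re v\<bar> + r" if "w \<in> cball v r" for w
      using that abs_Re_le_cmod[of "v - w"] by (auto simp: dist_norm)
    show "\<exists>r>0. \<exists>g. cball v r \<subseteq> ?S \<and> integrable lborel g \<and> (\<forall>w\<in>cball v r. \<forall>t\<in>space lborel.
        cmod (indicat_real {pi * b..} t *\<^sub>R (exp (w * of_real t) * S_kernel b (of_real t))) \<le> g t)"
      using r g Re by (intro exI[of _ r] exI[of _ g] conjI) (force intro!: g(2))+
  qed (auto intro!: holomorphic_intros)
  have minus: "(\<lambda>v. half_line_part b (- v)) holomorphic_on ?S"
  proof -
    have "((\<lambda>v. half_line_part b v) \<circ> uminus) holomorphic_on ?S"
      by (rule holomorphic_on_compose_gen[OF _ line]) (auto intro!: holomorphic_intros)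
    then show ?thesis by (simp only: o_def)
  qed
  have circ: "(\<lambda>v. half_circle_part b v) holomorphic_on ?S"
  proof -
    let ?c = "\<lambda>\<theta>. of_real (pi * b) * cis \<theta>"
    have K: "continuous_on UNIV (\<lambda>\<theta>. S_kernel b (?c \<theta>))"
      by (rule continuous_on_compose2[OF S_kernel_continuous_circle[OF b]])
         (use b in \<open>auto intro!: continuous_intros simp: norm_mult\<close>)
    have "(\<lambda>v. integral (cbox 0 pi) (\<lambda>\<theta>. exp (v * ?c \<theta>) * S_kernel b (?c \<theta>) * of_real (pi * b) * \<i>
        * cis \<theta>)) holomorphic_on UNIV"
    proof (rule leibniz_rule_holomorphic[where fx="\<lambda>v \<theta>. ?c \<theta>
        * (exp (v * ?c \<theta>) * S_kernel b (?c \<theta>) * of_real (pi * b) * \<i> * cis \<theta>)"])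
      show "(\<lambda>\<theta>. exp (v * ?c \<theta>) * S_kernel b (?c \<theta>) * of_real (pi * b) * \<i>
          * cis \<theta>) integrable_on cbox 0 pi" for v
        by (intro integrable_continuous continuous_intros continuous_on_subset[OF K]) auto
      show "continuous_on (UNIV \<times> cbox 0 pi)
          (\<lambda>(v, \<theta>). ?c \<theta> * (exp (v * ?c \<theta>) * S_kernel b (?c \<theta>) * of_real (pi * b) * \<i> * cis \<theta>))"
        unfolding case_prod_beta by (intro continuous_intros continuous_on_compose2[OF K]) auto
    qed (auto intro!: derivative_eq_intros)
    then have "(\<lambda>v. - integral {0..pi} (\<lambda>\<theta>. exp (v * ?c \<theta>) * S_kernel b (?c \<theta>) * of_real (pi * b)
        * \<i> * cis \<theta>)) holomorphic_on ?S"
      by (intro holomorphic_intros) (auto intro: holomorphic_on_subset)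
    moreover have "half_circle_part b v = - integral {0..pi} (\<lambda>\<theta>. exp (v * ?c \<theta>)
        * S_kernel b (?c \<theta>) * of_real (pi * b) * \<i> * cis \<theta>)" for v
      by (subst contour_integral_part_circlepath_reverse, subst contour_integral_part_circlepath_eq) auto
    ultimately show ?thesis by simp
  qed
  show ?thesis
    unfolding S_transform_decompose by (intro holomorphic_intros line minus circ)
qed

lemma S_fun_holomorphic:
  assumes b: "0 < b" "b < 1"
  shows "S_fun b holomorphic_on {z. 0 < Re z \<and> Re z < Q b}"
proof (rule holomorphic_transform)
  let ?S = "{z. 0 < Re z \<and> Re z < Q b}"
  have strip: "z \<in> ?S \<Longrightarrow> \<bar>Q b / 2 - Re z\<bar> < Q b / 2" for z
    by (simp only: abs_less_iff mem_Collect_eq) linarith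
  have "(S_transform b \<circ> (\<lambda>z. of_real (Q b) / 2 - z)) holomorphic_on ?S"
    by (rule holomorphic_on_compose_gen[OF _ S_transform_holomorphic[OF b]])
       (use strip in \<open>auto intro!: holomorphic_intros\<close>)
  then have 1: "(\<lambda>z. S_transform b (of_real (Q b) / 2 - z)) holomorphic_on ?S" by (simp only: o_def)
  have "(S_transform b \<circ> (\<lambda>z. - (of_real (Q b) / 2 - z))) holomorphic_on ?S"
    by (rule holomorphic_on_compose_gen[OF _ S_transform_holomorphic[OF b]])
       (use strip in \<open>auto intro!: holomorphic_intros simp: abs_minus_commute\<close>)
  then have 2: "(\<lambda>z. S_transform b (- (of_real (Q b) / 2 - z))) holomorphic_on ?S"
    by (simp only: o_def)
  show "(\<lambda>z. exp ((S_transform b (of_real (Q b) / 2 - z)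
      - S_transform b (- (of_real (Q b) / 2 - z))) / 2)) holomorphic_on ?S"
    by (intro holomorphic_intros 1 2) auto
qed (use S_fun_eq[OF b] in auto)

text \<open>Of the two transforms at \<open>w\<close> and \<open>- w\<close> the one with non-negative imaginary part of the argument is
  bounded. Eliminating the other one by \<open>S_transform_add_minus\<close> leaves the quadratic polynomial
  \<open>pi * \<i> / 2 * (w\<^sup>2 + h)\<close> up to sign, whose real part gives the decay.\<close>

lemma S_fun_bound:
  assumes b: "0 < b" "b < 1" and p: "0 < p0"
  obtains C where "C > 0"
    "\<And>z. p0 \<le> Re z \<Longrightarrow> Re z \<le> Q b / 2 \<Longrightarrow> cmod (S_fun b z) \<le> C * exp (- pi * \<bar>Im z\<bar> * (Q b / 2 - Re z))"
proof -
  obtain h where h: "\<And>v. S_transform b v + S_transform b (- v) = - (pi * \<i> * (v\<^sup>2 + h))"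
    using S_transform_add_minus[OF b] by blast
  have Q: "Q b > 0" using b by (simp add: Q_def add_pos_pos)
  obtain B where B: "\<And>v. \<bar>Re v\<bar> \<le> Q b / 2 - p0 \<Longrightarrow> 0 \<le> Im v \<Longrightarrow> cmod (S_transform b v) \<le> B"
    using S_transform_bounded[OF b, of "Q b / 2 - p0"] p by auto
  show ?thesis
  proof (rule that)
    show "0 < exp (B + pi / 2 * \<bar>Im h\<bar>)" by simp
    fix z assume z: "p0 \<le> Re z" "Re z \<le> Q b / 2"
    define w where "w = of_real (Q b) / 2 - z"
    have w: "Re w = Q b / 2 - Re z" "Im w = - Im z" by (auto simp: w_def)
    have "Re ((S_transform b w - S_transform b (- w)) / 2)
        \<le> B + pi / 2 * \<bar>Im h\<bar> - pi * \<bar>Im z\<bar> * (Q b / 2 - Re z)"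
    proof (cases "Im z \<ge> 0")
      case True
      have plus: "S_transform b w = - (pi * \<i> * (w\<^sup>2 + h)) - S_transform b (- w)"
        using h[of w] by (simp only: eq_diff_eq)
      have half: "(S_transform b w - S_transform b (- w)) / 2
          = - S_transform b (- w) - pi * \<i> / 2 * (w\<^sup>2 + h)"
        unfolding plus by (simp add: field_simps)
      have e1: "Re ((S_transform b w - S_transform b (- w)) / 2)
          = - Re (S_transform b (- w)) + pi / 2 * (Im (w\<^sup>2) + Im h)"
        unfolding half by (simp add: field_simps)
      have e2: "- Re (S_transform b (- w)) \<le> B"
        using B[of "- w"] abs_Re_le_cmod[of "S_transform b (- w)"] w z True by simp
      have e3: "Im (w\<^sup>2) = - 2 * \<bar>Im z\<bar> * (Q b / 2 - Re z)"
        using True w by (simp add: power2_eq_square)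
      have e4: "pi / 2 * Im h \<le> pi / 2 * \<bar>Im h\<bar>" by simp
      have e5: "pi / 2 * (- 2 * \<bar>Im z\<bar> * (Q b / 2 - Re z)) = - (pi * \<bar>Im z\<bar> * (Q b / 2 - Re z))"
        by simp
      show ?thesis unfolding e1 e3 distrib_left e5 using e2 e4 by linarith
    next
      case False
      have minus: "S_transform b (- w) = - (pi * \<i> * (w\<^sup>2 + h)) - S_transform b w"
        using h[of w] by (simp only: eq_diff_eq add.commute)
      have half: "(S_transform b w - S_transform b (- w)) / 2
          = S_transform b w + pi * \<i> / 2 * (w\<^sup>2 + h)"
        unfolding minus by (simp add: field_simps)
      have e1: "Re ((S_transform b w - S_transform b (- w)) / 2)
          = Re (S_transform b w) - pi / 2 * (Im (w\<^sup>2) + Im h)"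
        unfolding half by (simp add: field_simps)
      have e2: "Re (S_transform b w) \<le> B"
        using B[of w] abs_Re_le_cmod[of "S_transform b w"] w z False by simp
      have e3: "Im (w\<^sup>2) = 2 * \<bar>Im z\<bar> * (Q b / 2 - Re z)"
        using False w by (simp add: power2_eq_square)
      have e4: "- (pi / 2 * Im h) \<le> pi / 2 * \<bar>Im h\<bar>"
        by (metis abs_ge_minus_self mult_left_mono mult_minus_right pi_half_ge_zero)
      have e5: "pi / 2 * (2 * \<bar>Im z\<bar> * (Q b / 2 - Re z)) = pi * \<bar>Im z\<bar> * (Q b / 2 - Re z)"
        by simp
      show ?thesis unfolding e1 e3 distrib_left e5 using e2 e4 by linarith
    qed
    moreover have "S_fun b z = exp ((S_transform b w - S_transform b (- w)) / 2)"
      unfolding w_def using S_fun_eq[OF b] z p Q by simp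
    ultimately have "cmod (S_fun b z) \<le> exp (B + pi / 2 * \<bar>Im h\<bar> - pi * \<bar>Im z\<bar> * (Q b / 2 - Re z))"
      by simp
    then show "cmod (S_fun b z) \<le> exp (B + pi / 2 * \<bar>Im h\<bar>)
        * exp (- pi * \<bar>Im z\<bar> * (Q b / 2 - Re z))"
      by (simp add: exp_add[symmetric])
  qed
qed

section \<open>The ideal 6j symbol\<close>

lemma Q_pos: "0 < b \<Longrightarrow> 0 < Q b"
  by (simp add: Q_def add_pos_pos)

lemma norm_T_fun: "cmod (T_fun b z) = exp (pi * Im z * (Re z - Q b / 2))"
  unfolding T_fun_def norm_exp_eq_Re by (simp add: power2_eq_square field_simps)

lemma norm_T_sqrt: "cmod (T_sqrt b z) = exp (pi / 2 * Im z * (Re z - Q b / 2))"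
  unfolding T_sqrt_def norm_exp_eq_Re by (simp add: power2_eq_square field_simps)

text \<open>The integrand of the ideal 6j symbol as a function of the complex variable \<open>u\<close>, and the factor in
  front of the integral.\<close>

definition sixj_integrand ::
  "real \<Rightarrow> complex \<Rightarrow> complex \<Rightarrow> complex \<Rightarrow> complex \<Rightarrow> complex \<Rightarrow> complex \<Rightarrow> complex \<Rightarrow> complex" where
  "sixj_integrand b a1 a2 a3 a4 a5 a6 u =
     (\<Prod>t\<leftarrow>[a1 + a2 + a3, a1 + a5 + a6, a2 + a4 + a6, a3 + a4 + a5]. T_fun b (u - t))
         / T_fun b (of_real (2 * Q b) - u) *
     (\<Prod>q\<leftarrow>[a1 + a2 + a4 + a5, a1 + a3 + a4 + a6, a2 + a3 + a5 + a6]. S_fun b (q - u))"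

definition sixj_prefactor ::
  "real \<Rightarrow> complex \<Rightarrow> complex \<Rightarrow> complex \<Rightarrow> complex \<Rightarrow> complex \<Rightarrow> complex \<Rightarrow> complex" where
  "sixj_prefactor b a1 a2 a3 a4 a5 a6 =
     (let ts = [a1 + a2 + a3, a1 + a5 + a6, a2 + a4 + a6, a3 + a4 + a5];
          qs = [a1 + a2 + a4 + a5, a1 + a3 + a4 + a6, a2 + a3 + a5 + a6]
      in (\<Prod>t\<leftarrow>ts. T_sqrt b (of_real (2 * Q b) - t)) / (\<Prod>t\<leftarrow>ts. \<Prod>q\<leftarrow>qs. T_sqrt b (q - t)))"

lemma ideal_6j_eq:
  "ideal_6j b c a1 a2 a3 a4 a5 a6 = sixj_prefactor b a1 a2 a3 a4 a5 a6 *
     (LINT y|lborel. sixj_integrand b a1 a2 a3 a4 a5 a6 (Complex c y))"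
  unfolding ideal_6j_def sixj_prefactor_def sixj_integrand_def Let_def ..

lemma norm_sixj_prefactor:
  assumes "Re a1 = Q b / 2" "Re a2 = Q b / 2" "Re a3 = Q b / 2" "Re a4 = Q b / 2"
    "Re a5 = Q b / 2" "Re a6 = Q b / 2"
  shows "cmod (sixj_prefactor b a1 a2 a3 a4 a5 a6) = 1"
  unfolding sixj_prefactor_def Let_def
  by (simp add: norm_mult norm_divide norm_T_sqrt assms)

text \<open>The left-hand side is a concave piecewise linear function of \<open>x\<close>. To the left of \<open>m\<close> its slope is
  at least \<open>4 * d\<close>, to the right of \<open>m\<close> it is \<open>6 * d - q\<close>; the maximum is attained at \<open>x = m\<close>.\<close>

lemma piecewise_linear_bound:
  fixes q d x s1 s2 s3 :: real
  assumes d: "0 < d" "6 * d < q"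
  defines "S \<equiv> s1 + s2 + s3" and "m \<equiv> max s1 (max s2 s3)"
  shows "- S * (q / 2 + d) + x * (q / 2 + 3 * d) - (q / 2 - d) * (\<bar>x - s1\<bar> + \<bar>x - s2\<bar> + \<bar>x - s3\<bar>)
     \<le> - 2 * d * S + (6 * d - q) * m - min (4 * d) (q - 6 * d) * \<bar>x - m\<bar>"
proof -
  have combine: "A - X \<le> B - Y" if "P \<le> X" "Y \<le> Z" "A - P = B - Z" for A B P X Y Z :: real
    using that by linarith
  show ?thesis
  proof (cases "m \<le> x")
    case True
    have T: "3 * x - S \<le> \<bar>x - s1\<bar> + \<bar>x - s2\<bar> + \<bar>x - s3\<bar>" unfolding S_def by linarith
    have "(q / 2 - d) * (3 * x - S) \<le> (q / 2 - d) * (\<bar>x - s1\<bar> + \<bar>x - s2\<bar> + \<bar>x - s3\<bar>)"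
      by (rule mult_left_mono[OF T]) (use d in simp)
    moreover have "min (4 * d) (q - 6 * d) * \<bar>x - m\<bar> \<le> (q - 6 * d) * (x - m)"
      using True d by (intro mult_mono) auto
    moreover have "- S * (q / 2 + d) + x * (q / 2 + 3 * d) - (q / 2 - d) * (3 * x - S)
        = - 2 * d * S + (6 * d - q) * m - (q - 6 * d) * (x - m)"
      by (simp add: field_simps)
    ultimately show ?thesis by (rule combine)
  next
    case False
    have T: "x + 2 * m - S \<le> \<bar>x - s1\<bar> + \<bar>x - s2\<bar> + \<bar>x - s3\<bar>" unfolding S_def m_def max_def
      by (simp split: if_splits) linarith
    have "(q / 2 - d) * (x + 2 * m - S) \<le> (q / 2 - d) * (\<bar>x - s1\<bar> + \<bar>x - s2\<bar> + \<bar>x - s3\<bar>)"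
      by (rule mult_left_mono[OF T]) (use d in simp)
    moreover have "min (4 * d) (q - 6 * d) * \<bar>x - m\<bar> \<le> 4 * d * (m - x)"
      using False d by (intro mult_mono) auto
    moreover have "- S * (q / 2 + d) + x * (q / 2 + 3 * d) - (q / 2 - d) * (x + 2 * m - S)
        = - 2 * d * S + (6 * d - q) * m - 4 * d * (m - x)"
      by (simp add: field_simps)
    ultimately show ?thesis by (rule combine)
  qed
qed

text \<open>The substitution \<open>v = S - x\<close> for the imaginary part \<open>v\<close> of the variable turns the arguments
  \<open>q_j - u\<close> of the double sine functions into \<open>Complex d (x - s)\<close>, where \<open>s\<close> runs through the sums
  over pairs of opposite edges. The constants are uniform in \<open>d\<close> on a compact interval, as needed to
  move the contour.\<close>

lemma sixj_integrand_bound: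
  assumes b: "0 < b" "b < 1" and d: "0 < d0" "6 * d1 < Q b" "d0 \<le> d1"
  obtains C k where "C > 0" "k > 0"
    "\<And>d v y1 y2 y3 y4 y5 y6 S m. d0 \<le> d \<Longrightarrow> d \<le> d1 \<Longrightarrow> S = (y1 + y4) + (y2 + y5) + (y3 + y6) \<Longrightarrow>
       m = max (y1 + y4) (max (y2 + y5) (y3 + y6)) \<Longrightarrow>
       cmod (sixj_integrand b (Complex (Q b / 2) y1) (Complex (Q b / 2) y2) (Complex (Q b / 2) y3)
         (Complex (Q b / 2) y4) (Complex (Q b / 2) y5) (Complex (Q b / 2) y6)
             (Complex (2 * Q b - d) v))
       \<le> C * exp (pi * (- 2 * d * S + (6 * d - Q b) * m)) * exp (- k * \<bar>v - (S - m)\<bar>)"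
proof -
  obtain C where C: "C > 0"
    "\<And>z. d0 \<le> Re z \<Longrightarrow> Re z \<le> Q b / 2 \<Longrightarrow> cmod (S_fun b z) \<le> C * exp (- pi * \<bar>Im z\<bar> * (Q b / 2 - Re z))"
    using S_fun_bound[OF b d(1)] by blast
  define k where "k = min (4 * d0) (Q b - 6 * d1)"
  have k: "k > 0" using d by (simp add: k_def)
  show ?thesis
  proof (rule that)
    show "C ^ 3 > 0" "pi * k > 0" using C k by auto
    fix d v y1 y2 y3 y4 y5 y6 S m :: real
    assume dd: "d0 \<le> d" "d \<le> d1" and S: "S = (y1 + y4) + (y2 + y5) + (y3 + y6)"
      and m: "m = max (y1 + y4) (max (y2 + y5) (y3 + y6))"
    let ?a = "\<lambda>y. Complex (Q b / 2) y"
    let ?u = "Complex (2 * Q b - d) v"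
    define x where "x = S - v"
    have dQ: "d \<le> Q b / 2" using dd(2) d(2) Q_pos[OF b(1)] by linarith
    have T: "cmod (T_fun b (?u - (?a y + ?a y' + ?a y'')))
        = exp (pi * (- d * (v - (y + y' + y''))))" for y y' y''
      unfolding norm_T_fun by (simp add: field_simps)
    have T': "cmod (T_fun b (of_real (2 * Q b) - ?u)) = exp (pi * (v * (Q b / 2 - d)))"
      unfolding norm_T_fun by (simp add: field_simps)
    have Sb: "cmod (S_fun b (?a y + ?a y' + ?a y'' + ?a y''' - ?u))
        \<le> C * exp (pi * (- \<bar>(y + y' + y'' + y''') - v\<bar> * (Q b / 2 - d)))" for y y' y'' y'''
    proof -
      let ?z = "?a y + ?a y' + ?a y'' + ?a y''' - ?u"
      have Re: "Re ?z = d" and Im: "Im ?z = (y + y' + y'' + y''') - v" by simp_all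
      have "cmod (S_fun b ?z) \<le> C * exp (- pi * \<bar>Im ?z\<bar> * (Q b / 2 - Re ?z))"
        by (rule C(2)) (unfold Re, use dd dQ in auto)
      then show ?thesis unfolding Re Im by (simp only: mult.assoc mult_minus_left mult_minus_right)
    qed
    have S3: "cmod (S_fun b (?a y1 + ?a y2 + ?a y4 + ?a y5 - ?u))
        * (cmod (S_fun b (?a y1 + ?a y3 + ?a y4 + ?a y6 - ?u)) *
         cmod (S_fun b (?a y2 + ?a y3 + ?a y5 + ?a y6 - ?u)))
       \<le> (C * exp (pi * (- \<bar>x - (y3 + y6)\<bar> * (Q b / 2 - d))))
           * ((C * exp (pi * (- \<bar>x - (y2 + y5)\<bar> * (Q b / 2 - d)))) *
         (C * exp (pi * (- \<bar>x - (y1 + y4)\<bar> * (Q b / 2 - d)))))"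
    proof (intro mult_mono)
      have "x - (y3 + y6) = (y1 + y2 + y4 + y5) - v" "x - (y2 + y5) = (y1 + y3 + y4 + y6) - v"
        "x - (y1 + y4) = (y2 + y3 + y5 + y6) - v" by (auto simp: x_def S)
      then show "cmod (S_fun b (?a y1 + ?a y2 + ?a y4 + ?a y5 - ?u))
          \<le> C * exp (pi * (- \<bar>x - (y3 + y6)\<bar> * (Q b / 2 - d)))"
        "cmod (S_fun b (?a y1 + ?a y3 + ?a y4 + ?a y6 - ?u))
            \<le> C * exp (pi * (- \<bar>x - (y2 + y5)\<bar> * (Q b / 2 - d)))"
        "cmod (S_fun b (?a y2 + ?a y3 + ?a y5 + ?a y6 - ?u))
            \<le> C * exp (pi * (- \<bar>x - (y1 + y4)\<bar> * (Q b / 2 - d)))"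
        using Sb by presburger+
    qed (use C in auto)
    have "cmod (sixj_integrand b (?a y1) (?a y2) (?a y3) (?a y4) (?a y5) (?a y6) ?u)
       = exp (pi * (- d * (4 * v - 2 * S))) / exp (pi * (v * (Q b / 2 - d))) *
        (cmod (S_fun b (?a y1 + ?a y2 + ?a y4 + ?a y5 - ?u))
            * (cmod (S_fun b (?a y1 + ?a y3 + ?a y4 + ?a y6 - ?u)) *
         cmod (S_fun b (?a y2 + ?a y3 + ?a y5 + ?a y6 - ?u))))"
    proof -
      have "exp (pi * (- d * (v - (y1 + y2 + y3)))) * (exp (pi * (- d * (v - (y1 + y5 + y6)))) *
        (exp (pi * (- d * (v - (y2 + y4 + y6)))) * exp (pi * (- d * (v - (y3 + y4 + y5))))))
        = exp (pi * (- d * (4 * v - 2 * S)))"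
        unfolding exp_add[symmetric] S by (simp add: algebra_simps)
      then show ?thesis
        unfolding sixj_integrand_def list.map prod_list.Cons prod_list.Nil mult_1_right norm_mult norm_divide T T' by simp
    qed
    also have "\<dots> \<le> exp (pi * (- d * (4 * v - 2 * S))) / exp (pi * (v * (Q b / 2 - d))) *
       ((C * exp (pi * (- \<bar>x - (y3 + y6)\<bar> * (Q b / 2 - d))))
           * ((C * exp (pi * (- \<bar>x - (y2 + y5)\<bar> * (Q b / 2 - d)))) *
         (C * exp (pi * (- \<bar>x - (y1 + y4)\<bar> * (Q b / 2 - d))))))"
      by (rule mult_left_mono[OF S3]) simp
    also have "\<dots> = C ^ 3 * exp (pi * (- S * (Q b / 2 + d) + x * (Q b / 2 + 3 * d) - (Q b / 2 - d) *
        (\<bar>x - (y1 + y4)\<bar> + \<bar>x - (y2 + y5)\<bar> + \<bar>x - (y3 + y6)\<bar>)))"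
    proof -
      have "pi * (- S * (Q b / 2 + d) + x * (Q b / 2 + 3 * d) - (Q b / 2 - d) *
        (\<bar>x - (y1 + y4)\<bar> + \<bar>x - (y2 + y5)\<bar> + \<bar>x - (y3 + y6)\<bar>)) = 
         pi * (- d * (4 * v - 2 * S)) - pi * (v * (Q b / 2 - d))
             + (pi * (- \<bar>x - (y3 + y6)\<bar> * (Q b / 2 - d))
         + (pi * (- \<bar>x - (y2 + y5)\<bar> * (Q b / 2 - d)) + pi * (- \<bar>x - (y1 + y4)\<bar> * (Q b / 2 - d))))"
        unfolding x_def by (simp add: field_simps)
      then show ?thesis by (simp only: exp_add exp_diff power3_eq_cube mult_ac times_divide_eq_left times_divide_eq_right)
    qed
    also have "\<dots> \<le> C ^ 3 * exp
        (pi * (- 2 * d * S + (6 * d - Q b) * m - min (4 * d) (Q b - 6 * d) * \<bar>x - m\<bar>))"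
      unfolding S m using piecewise_linear_bound[of d "Q b" "y1 + y4" "y2 + y5"
        "y3 + y6" x] dd d C(1) by simp
    also have "\<dots> \<le> C ^ 3 * exp (pi * (- 2 * d * S + (6 * d - Q b) * m - k * \<bar>v - (S - m)\<bar>))"
    proof -
      have "\<bar>x - m\<bar> = \<bar>v - (S - m)\<bar>" by (simp add: x_def)
      moreover have "k * \<bar>v - (S - m)\<bar> \<le> min (4 * d) (Q b - 6 * d) * \<bar>v - (S - m)\<bar>"
        by (rule mult_right_mono) (use dd in \<open>auto simp: k_def\<close>)
      ultimately show ?thesis using C(1) by simp
    qed
    also have "\<dots> = C ^ 3 * exp (pi * (- 2 * d * S + (6 * d - Q b) * m))
        * exp (- (pi * k) * \<bar>v - (S - m)\<bar>)"
    proof -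
      have "pi * (r - k * t) = pi * r + - (pi * k) * t" for r t by (simp add: algebra_simps)
      then show ?thesis by (simp only: exp_add mult.assoc)
    qed
    finally show "cmod (sixj_integrand b (?a y1) (?a y2) (?a y3) (?a y4) (?a y5) (?a y6) ?u)
      \<le> C ^ 3 * exp (pi * (- 2 * d * S + (6 * d - Q b) * m)) * exp (- (pi * k) * \<bar>v - (S - m)\<bar>)" .
  qed
qed

lemma sixj_integrand_holomorphic:
  assumes b: "0 < b" "b < 1"
    and "Re a1 = Q b / 2" "Re a2 = Q b / 2" "Re a3 = Q b / 2" "Re a4 = Q b / 2" "Re a5 = Q b / 2"
      "Re a6 = Q b / 2"
  shows "sixj_integrand b a1 a2 a3 a4 a5 a6 holomorphic_on {u. Q b < Re u \<and> Re u < 2 * Q b}"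
proof -
  have T: "(\<lambda>u. T_fun b (f u)) holomorphic_on A" if "f holomorphic_on A" for f A
    unfolding T_fun_def by (intro holomorphic_intros that)
  have T0: "T_fun b z \<noteq> 0" for z by (simp add: T_fun_def)
  have S: "(\<lambda>u. S_fun b (q - u)) holomorphic_on {u. Q b < Re u \<and> Re u < 2 * Q b}"
    if "Re q = 2 * Q b" for q
  proof -
    have "(S_fun b \<circ> (\<lambda>u. q - u)) holomorphic_on {u. Q b < Re u \<and> Re u < 2 * Q b}"
      by (rule holomorphic_on_compose_gen[OF _ S_fun_holomorphic[OF b]])
         (use that in \<open>auto intro!: holomorphic_intros\<close>)
    then show ?thesis by (simp only: o_def)
  qed
  show ?thesis
    unfolding sixj_integrand_def list.map prod_list.Cons prod_list.Nil mult_1_right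
    by (intro holomorphic_intros T S T0) (use assms in auto)
qed

lemma ideal_6j_contour_independent_aux:
  assumes b: "0 < b" "b < 1" and c: "11 * Q b / 6 < c" "c \<le> c'" "c' < 2 * Q b"
  shows "ideal_6j b c (Complex (Q b / 2) y1) (Complex (Q b / 2) y2) (Complex (Q b / 2) y3)
           (Complex (Q b / 2) y4) (Complex (Q b / 2) y5) (Complex (Q b / 2) y6)
       = ideal_6j b c' (Complex (Q b / 2) y1) (Complex (Q b / 2) y2) (Complex (Q b / 2) y3)
           (Complex (Q b / 2) y4) (Complex (Q b / 2) y5) (Complex (Q b / 2) y6)"
proof -
  let ?a = "\<lambda>y. Complex (Q b / 2) y"
  let ?g = "sixj_integrand b (?a y1) (?a y2) (?a y3) (?a y4) (?a y5) (?a y6)"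
  define S m where "S = (y1 + y4) + (y2 + y5) + (y3 + y6)"
    and "m = max (y1 + y4) (max (y2 + y5) (y3 + y6))"
  obtain C k where Ck: "C > 0" "k > 0" and bound:
    "\<And>d v. 2 * Q b - c' \<le> d \<Longrightarrow> d \<le> 2 * Q b - c \<Longrightarrow>
       cmod (?g (Complex (2 * Q b - d) v))
           \<le> C * exp (pi * (- 2 * d * S + (6 * d - Q b) * m)) * exp (- k * \<bar>v - (S - m)\<bar>)"
    by (rule sixj_integrand_bound[OF b, of "2 * Q b - c'" "2 * Q b - c"])
      (use c S_def m_def in auto)
  define B where "B = C * exp (pi * (2 * Q b * \<bar>S\<bar> + Q b * \<bar>m\<bar>)) * exp (k * \<bar>S - m\<bar>)"
  have "(LINT y|lborel. ?g (Complex c y)) = (LINT y|lborel. ?g (Complex c' y))"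
  proof (rule vertical_line_integral_cong[OF sixj_integrand_holomorphic[OF b]])
    show "Q b < c" using c Q_pos[OF b(1)] by (simp add: field_simps)
    fix x y assume x: "c \<le> x" "x \<le> c'"
    define d where "d = 2 * Q b - x"
    have d: "2 * Q b - c' \<le> d" "d \<le> 2 * Q b - c" "0 < d" "6 * d < Q b" using x c
      by (auto simp: d_def)
    have "cmod (?g (Complex (2 * Q b - d) y))
        \<le> C * exp (pi * (- 2 * d * S + (6 * d - Q b) * m)) * exp (- k * \<bar>y - (S - m)\<bar>)"
      by (rule bound) (use d in auto)
    also have "\<dots> \<le> C * exp (pi * (2 * Q b * \<bar>S\<bar> + Q b * \<bar>m\<bar>)) * exp (k * \<bar>S - m\<bar> - k * \<bar>y\<bar>)"
    proof (intro mult_mono)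
      have "- 2 * d * S \<le> 2 * Q b * \<bar>S\<bar>"
      proof -
        have "- 2 * d * S \<le> 2 * d * \<bar>S\<bar>" using d(3) by (simp add: abs_if)
        also have "\<dots> \<le> 2 * Q b * \<bar>S\<bar>" using d by (intro mult_right_mono) auto
        finally show ?thesis .
      qed
      moreover have "(6 * d - Q b) * m \<le> Q b * \<bar>m\<bar>"
      proof -
        have "(6 * d - Q b) * m \<le> \<bar>6 * d - Q b\<bar> * \<bar>m\<bar>" by (metis abs_ge_self abs_mult)
        also have "\<dots> \<le> Q b * \<bar>m\<bar>" using d by (intro mult_right_mono) auto
        finally show ?thesis .
      qed
      ultimately show "exp (pi * (- 2 * d * S + (6 * d - Q b) * m))
          \<le> exp (pi * (2 * Q b * \<bar>S\<bar> + Q b * \<bar>m\<bar>))"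
        by (intro iffD2[OF exp_le_cancel_iff] mult_left_mono add_mono) auto
      have "k * \<bar>y\<bar> \<le> k * (\<bar>y - (S - m)\<bar> + \<bar>S - m\<bar>)" using Ck(2) by (intro mult_left_mono) auto
      then show "exp (- k * \<bar>y - (S - m)\<bar>) \<le> exp (k * \<bar>S - m\<bar> - k * \<bar>y\<bar>)"
        by (simp add: algebra_simps)
    qed (use Ck in auto)
    also have "\<dots> = B * exp (- k * \<bar>y\<bar>)" by (simp add: B_def exp_diff exp_minus field_simps)
    finally show "cmod (?g (Complex x y)) \<le> B * exp (- k * \<bar>y\<bar>)" by (simp add: d_def)
  qed (use c Ck in auto)
  then show ?thesis unfolding ideal_6j_eq by (simp only:)
qed

lemma ideal_6j_contour_independent:
  assumes b: "0 < b" "b < 1" and c: "11 * Q b / 6 < c" "c < 2 * Q b" and c': "11 * Q b / 6 < c'"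
    "c' < 2 * Q b"
  shows "ideal_6j b c (Complex (Q b / 2) y1) (Complex (Q b / 2) y2) (Complex (Q b / 2) y3)
           (Complex (Q b / 2) y4) (Complex (Q b / 2) y5) (Complex (Q b / 2) y6)
       = ideal_6j b c' (Complex (Q b / 2) y1) (Complex (Q b / 2) y2) (Complex (Q b / 2) y3)
           (Complex (Q b / 2) y4) (Complex (Q b / 2) y5) (Complex (Q b / 2) y6)"
  using ideal_6j_contour_independent_aux[OF b c(1) _ c'(2)] ideal_6j_contour_independent_aux[OF b c'(1) _ c(2)]
    linorder_linear[of c c'] by metis

lemma ideal_6j_bound:
  assumes b: "0 < b" "b < 1" and d: "0 < d" "6 * d < Q b"
  obtains C where "C > 0"
    "\<And>y1 y2 y3 y4 y5 y6 S m. S = (y1 + y4) + (y2 + y5) + (y3 + y6) \<Longrightarrow>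
       m = max (y1 + y4) (max (y2 + y5) (y3 + y6)) \<Longrightarrow>
       cmod (ideal_6j b (2 * Q b - d) (Complex (Q b / 2) y1) (Complex (Q b / 2) y2)
           (Complex (Q b / 2) y3)
         (Complex (Q b / 2) y4) (Complex (Q b / 2) y5) (Complex (Q b / 2) y6))
       \<le> C * exp (pi * (- 2 * d * S + (6 * d - Q b) * m))"
proof -
  obtain C k where Ck: "C > 0" "k > 0" and bound:
    "\<And>d' v y1 y2 y3 y4 y5 y6 S m. d \<le> d' \<Longrightarrow> d' \<le> d \<Longrightarrow> S = (y1 + y4) + (y2 + y5) + (y3 + y6) \<Longrightarrow>
       m = max (y1 + y4) (max (y2 + y5) (y3 + y6)) \<Longrightarrow>
       cmod (sixj_integrand b (Complex (Q b / 2) y1) (Complex (Q b / 2) y2) (Complex (Q b / 2) y3)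
         (Complex (Q b / 2) y4) (Complex (Q b / 2) y5) (Complex (Q b / 2) y6)
             (Complex (2 * Q b - d') v))
       \<le> C * exp (pi * (- 2 * d' * S + (6 * d' - Q b) * m)) * exp (- k * \<bar>v - (S - m)\<bar>)"
    by (rule sixj_integrand_bound[OF b d order_refl]) blast
  define I where "I = (LINT v|lborel. exp (- k * \<bar>v\<bar>))"
  have I: "I \<ge> 0" unfolding I_def by (rule integral_nonneg_AE) simp
  show ?thesis
  proof (rule that)
    show "C * (I + 1) > 0" using Ck I by simp
    fix y1 y2 y3 y4 y5 y6 S m :: real
    assume S: "S = (y1 + y4) + (y2 + y5) + (y3 + y6)"
      and m: "m = max (y1 + y4) (max (y2 + y5) (y3 + y6))"
    let ?a = "\<lambda>y. Complex (Q b / 2) y"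
    let ?g = "sixj_integrand b (?a y1) (?a y2) (?a y3) (?a y4) (?a y5) (?a y6)"
    define E where "E = C * exp (pi * (- 2 * d * S + (6 * d - Q b) * m))"
    have E: "E > 0" using Ck by (simp add: E_def)
    have int: "integrable lborel (\<lambda>v. exp (- k * \<bar>- (S - m) + 1 * v\<bar>))"
      by (rule lborel_integrable_real_affine[OF integrable_exp_abs[OF Ck(2)]]) simp
    have le: "cmod (?g (Complex (2 * Q b - d) v)) \<le> E * exp (- k * \<bar>- (S - m) + 1 * v\<bar>)" for v
    proof -
      have "\<bar>- (S - m) + 1 * v\<bar> = \<bar>v - (S - m)\<bar>" by simp
      then show ?thesis
        unfolding E_def using bound[OF order_refl order_refl S m, of v] by (simp only:)
    qed
    have "cmod (LINT v|lborel. ?g (Complex (2 * Q b - d) v))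
        \<le> (LINT v|lborel. E * exp (- k * \<bar>- (S - m) + 1 * v\<bar>))"
    proof (cases "integrable lborel (\<lambda>v. ?g (Complex (2 * Q b - d) v))")
      case True
      then show ?thesis
        by (rule Bochner_Integration.integral_norm_bound_integral[OF _ integrable_mult_right[OF int] le])
    next
      case False
      then show ?thesis
        unfolding not_integrable_integral_eq[OF False] norm_zero
        using E by (intro integral_nonneg_AE AE_I2) simp
    qed
    also have "\<dots> = E * I"
      unfolding I_def using lborel_integral_real_affine[of 1 "\<lambda>v. exp (- k * \<bar>v\<bar>)" "- (S - m)"]
        by simp
    also have "\<dots> \<le> E * (I + 1)" using E by simp
    finally show "cmod (ideal_6j b (2 * Q b - d) (?a y1) (?a y2) (?a y3) (?a y4) (?a y5) (?a y6))
       \<le> C * (I + 1) * exp (pi * (- 2 * d * S + (6 * d - Q b) * m))"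
      unfolding ideal_6j_eq norm_mult by (subst norm_sixj_prefactor) (auto simp: E_def mult_ac)
  qed
qed

lemma ideal_6j_measurable:
  assumes b: "0 < b" "b < 1" and c: "Q b < c" "c < 2 * Q b"
    and [measurable]: "y1 \<in> borel_measurable M" "y2 \<in> borel_measurable M" "y3 \<in> borel_measurable M"
      "y4 \<in> borel_measurable M" "y5 \<in> borel_measurable M" "y6 \<in> borel_measurable M"
  shows "(\<lambda>x. ideal_6j b c (Complex (Q b / 2) (y1 x)) (Complex (Q b / 2) (y2 x))
      (Complex (Q b / 2) (y3 x))
           (Complex (Q b / 2) (y4 x)) (Complex (Q b / 2) (y5 x)) (Complex (Q b / 2) (y6 x)))
               \<in> borel_measurable M"
proof -
  have [measurable]: "T_fun b \<in> borel_measurable borel" "T_sqrt b \<in> borel_measurable borel"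
    unfolding T_fun_def T_sqrt_def
      by (auto intro!: borel_measurable_continuous_onI continuous_intros)
  have [measurable]: "Complex r \<in> borel_measurable borel" for r
    unfolding Complex_eq by (auto intro!: borel_measurable_continuous_onI continuous_intros)
  define s where "s = (\<lambda>v. S_fun b (Complex (2 * Q b - c) v))"
  have "continuous_on UNIV s"
    unfolding s_def
    by (rule continuous_on_compose2[OF holomorphic_on_imp_continuous_on[OF S_fun_holomorphic[OF b]]])
       (use c in \<open>auto simp: Complex_eq intro!: continuous_intros\<close>)
  then have [measurable]: "s \<in> borel_measurable borel" by (rule borel_measurable_continuous_onI)
  have s: "S_fun b (Complex (Q b / 2) v1 + Complex (Q b / 2) v2 + Complex (Q b / 2) v3
      + Complex (Q b / 2) v4 - Complex c v)
      = s (v1 + v2 + v3 + v4 - v)" for v1 v2 v3 v4 v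
    by (simp add: s_def complex_add complex_diff)
  show ?thesis
    unfolding ideal_6j_eq sixj_prefactor_def sixj_integrand_def Let_def list.map prod_list.Cons prod_list.Nil s
    by measurable
qed

section \<open>Cells of a triangulation and angle structures\<close>

text \<open>The vertices of a tetrahedron are numbered \<open>0, 1, 2, 3\<close>, whereas the library facts about the type
  \<open>4\<close> enumerate it as \<open>1, 2, 3, 4\<close>.\<close>

lemma UNIV_4_from_0: "(UNIV :: 4 set) = {0, 1, 2, 3}"
proof -
  have "(4::4) = 0" by simp
  then show ?thesis unfolding UNIV_4 by auto
qed

lemma all_4_from_0: "(\<forall>i::4. P i) \<longleftrightarrow> P 0 \<and> P 1 \<and> P 2 \<and> P 3"
proof -
  have "(\<forall>i::4. P i) \<longleftrightarrow> (\<forall>i\<in>{0,1,2,3}. P i)" unfolding UNIV_4_from_0[symmetric] by simp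
  then show ?thesis by simp
qed

lemma ex_4_from_0: "(\<exists>i::4. P i) \<longleftrightarrow> P 0 \<or> P 1 \<or> P 2 \<or> P 3"
proof -
  have "(\<exists>i::4. P i) \<longleftrightarrow> (\<exists>i\<in>{0,1,2,3}. P i)" unfolding UNIV_4_from_0[symmetric] by simp
  then show ?thesis by simp
qed

lemma pairs_4: "{s :: 4 set. card s = 2} = {{0,1},{0,2},{1,2},{2,3},{1,3},{0,3}}" (is "_ = ?P")
proof (intro equalityI subsetI)
  fix s :: "4 set" assume "s \<in> {s. card s = 2}"
  then obtain i j where s: "s = {i, j}" "i \<noteq> j" by (auto simp: card_2_iff)
  have all: "\<forall>i j::4. i \<noteq> j \<longrightarrow> {i, j} \<in> ?P"
    unfolding all_4_from_0 by (simp add: doubleton_eq_iff)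
  show "s \<in> ?P" unfolding s(1) by (rule all[THEN spec, THEN spec, THEN mp, OF s(2)])
next
  fix s assume "s \<in> ?P"
  then show "s \<in> {s. card s = 2}" by (elim insertE) simp_all
qed

lemma sum_pairs_4:
  fixes f :: "4 set \<Rightarrow> real"
  shows "(\<Sum>s | card s = 2. f s) = f {0,1} + f {0,2} + f {1,2} + f {2,3} + f {1,3} + f {0,3}"
  unfolding pairs_4 by (simp add: doubleton_eq_iff)

lemma sum_remove_4:
  fixes f :: "4 \<Rightarrow> real"
  shows "(\<Sum>j\<in>UNIV - {0}. f j) = f 1 + f 2 + f 3" "(\<Sum>j\<in>UNIV - {1}. f j) = f 0 + f 2 + f 3"
    "(\<Sum>j\<in>UNIV - {2}. f j) = f 0 + f 1 + f 3" "(\<Sum>j\<in>UNIV - {3}. f j) = f 0 + f 1 + f 2"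
  unfolding UNIV_4_from_0 by (simp_all add: sum_diff1)

lemma equiv_cell_equiv: "equiv UNIV (cell_equiv glue)"
  unfolding cell_equiv_def generated_equiv_def
  by (rule equivI) (simp_all add: refl_rtrancl trans_rtrancl sym_rtrancl sym_Un_converse)

lemma cell_equiv_invariant:
  assumes "(c, d) \<in> cell_equiv glue"
    and step: "\<And>t s t' \<pi> i. glue t i = (t', \<pi>) \<Longrightarrow> i \<notin> s \<Longrightarrow> F (t', \<pi> ` s) = F (t, s)"
  shows "F d = F c"
  using assms(1) unfolding cell_equiv_def generated_equiv_def
proof (induction rule: rtrancl_induct)
  case (step y z)
  then have "F z = F y" using assms(2) by auto
  with step.IH show ?case by simp
qed simp

lemma face_pairing_inj:
  assumes "face_pairing glue" "glue t i = (t', \<pi>)"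
  shows "inj \<pi>"
proof -
  have "case glue t i of (t', \<pi>) \<Rightarrow> bij \<pi> \<and> (t', \<pi> i) \<noteq> (t, i) \<and> glue t' (\<pi> i) = (t, inv \<pi>)"
    using assms(1)[unfolded face_pairing_def, THEN spec, THEN spec] .
  then show ?thesis by (simp add: assms(2) bij_is_inj)
qed

lemma cell_equiv_card:
  assumes "face_pairing glue" "(c, d) \<in> cell_equiv glue"
  shows "card (snd d) = card (snd c)"
  by (rule cell_equiv_invariant[OF assms(2), of "\<lambda>c. card (snd c)"])
     (simp add: card_image inj_on_subset[OF face_pairing_inj[OF assms(1)]])

lemma mem_cell_of: "(t, s) \<in> cell_of glue t s"
  unfolding cell_of_def by (rule equiv_class_self[OF equiv_cell_equiv UNIV_I])

lemma cell_of_in_edges: "card s = 2 \<Longrightarrow> cell_of glue t s \<in> edges glue"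
  unfolding edges_def cell_of_def by (rule quotientI) (simp add: corners_def)

lemma cell_of_in_boundary: "cell_of glue t {i} \<in> boundary_components glue"
  unfolding boundary_components_def cell_of_def by (rule quotientI) simp

lemma edge_eq_cell_of:
  assumes "e \<in> edges glue" "(t, s) \<in> e"
  shows "e = cell_of glue t s"
proof -
  obtain t0 s0 where e: "e = cell_equiv glue `` {(t0, s0)}"
    using assms(1) unfolding edges_def by (metis quotientE surj_pair)
  then have "((t0, s0), (t, s)) \<in> cell_equiv glue" using assms(2) by auto
  then show ?thesis unfolding e cell_of_def by (rule equiv_class_eq[OF equiv_cell_equiv])
qed

lemma edge_corners:
  assumes fp: "face_pairing glue" and e: "e \<in> edges glue"
  shows "{c \<in> corners. cell_of glue (fst c) (snd c) = e} = e"
proof (intro set_eqI iffI)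
  fix c assume "c \<in> {c \<in> corners. cell_of glue (fst c) (snd c) = e}"
  then show "c \<in> e" using mem_cell_of[of "fst c" "snd c" glue] by simp
next
  fix c assume c: "c \<in> e"
  obtain c0 where c0: "c0 \<in> corners" "e = cell_equiv glue `` {c0}"
    using e unfolding edges_def by (auto elim: quotientE)
  have "card (snd c) = card (snd c0)" using cell_equiv_card[OF fp, of c0 c] c c0(2) by auto
  then show "c \<in> {c \<in> corners. cell_of glue (fst c) (snd c) = e}"
    using c0(1) edge_eq_cell_of[OF e, of "fst c" "snd c"] c by (auto simp: corners_def)
qed

lemma edge_nonempty:
  assumes "face_pairing glue" "e \<in> edges glue"
  obtains t i j where "(t, {i, j}) \<in> e" "i \<noteq> j" "e = cell_of glue t {i, j}"
proof -
  obtain c0 where c0: "c0 \<in> corners" "e = cell_equiv glue `` {c0}"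
    using assms(2) unfolding edges_def by (auto elim: quotientE)
  obtain t s where ts: "c0 = (t, s)" by (cases c0)
  have e: "e = cell_of glue t s" unfolding c0 ts cell_of_def ..
  obtain i j where "s = {i, j}" "i \<noteq> j" using c0(1) unfolding ts corners_def
    by (auto simp: card_2_iff)
  then show ?thesis using that e mem_cell_of by metis
qed

lemma sum_edges_corners:
  fixes f :: "'t::finite \<times> 4 set \<Rightarrow> real"
  assumes "face_pairing glue"
  shows "(\<Sum>e\<in>edges glue. \<Sum>c\<in>e. f c) = (\<Sum>t\<in>UNIV. \<Sum>s | card s = 2. f (t, s))"
proof -
  have "(\<Sum>e\<in>edges glue. \<Sum>c\<in>e. f c) = (\<Sum>e\<in>edges glue. \<Sum>c | c \<in> corners
      \<and> cell_of glue (fst c) (snd c) = e. f c)"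
    by (intro sum.cong) (use edge_corners[OF assms] in auto)
  also have "\<dots> = (\<Sum>c\<in>corners. f c)"
    by (rule sum.group) (auto simp: corners_def intro: cell_of_in_edges)
  also have "corners = (UNIV :: 't set) \<times> {s. card s = 2}" by (auto simp: corners_def)
  also have "(\<Sum>c\<in>\<dots>. f c) = (\<Sum>t\<in>UNIV. \<Sum>s | card s = 2. f (t, s))"
    by (simp add: sum.cartesian_product)
  finally show ?thesis .
qed

text \<open>Opposite dihedral angles agree: the angle sums at the two ends of an edge minus those at the two
  ends of the opposite edge equal twice the difference of the two angles.\<close>

lemma angle_structure_opposite:
  assumes "angle_structure glue \<theta>"
  shows "\<theta> (t, {2,3}) = \<theta> (t, {0,1})" "\<theta> (t, {1,3}) = \<theta> (t, {0,2})" "\<theta> (t, {0,3}) = \<theta> (t, {1,2})"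
    "\<theta> (t, {0,1}) + \<theta> (t, {0,2}) + \<theta> (t, {1,2}) = pi"
proof -
  have *: "(\<Sum>j\<in>UNIV - {i}. \<theta> (t, {i, j})) = pi" for i
    using assms unfolding angle_structure_def by blast
  have c: "{1,0} = {0,1::4}" "{2,0} = {0,2::4}" "{3,0} = {0,3::4}" "{2,1} = {1,2::4}"
    "{3,1} = {1,3::4}" "{3,2} = {2,3::4}"
    by auto
  note eqs = *[of 0] *[of 1] *[of 2] *[of 3]
  show "\<theta> (t, {2,3}) = \<theta> (t, {0,1})" "\<theta> (t, {1,3}) = \<theta> (t, {0,2})" "\<theta> (t, {0,3}) = \<theta> (t, {1,2})"
    "\<theta> (t, {0,1}) + \<theta> (t, {0,2}) + \<theta> (t, {1,2}) = pi"
    using eqs unfolding sum_remove_4 c by linarith+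
qed

section \<open>The shape defect and the orbits of the boundary action\<close>

text \<open>For edge coordinates \<open>x\<close>, the shape defect of a tetrahedron measures how far the three sums of
  \<open>x\<close> over pairs of opposite edges are from being equal: it is the sum of their distances to their
  maximum.\<close>

definition shape_defect :: "'t::finite gluing \<Rightarrow> real ^ 't cell \<Rightarrow> 't \<Rightarrow> real" where
  "shape_defect glue x t =
     (let s1 = x $ cell_of glue t {0,1} + x $ cell_of glue t {2,3};
          s2 = x $ cell_of glue t {0,2} + x $ cell_of glue t {1,3};
          s3 = x $ cell_of glue t {1,2} + x $ cell_of glue t {0,3}
      in 3 * max s1 (max s2 s3) - (s1 + s2 + s3))"

lemma max3_defect:
  fixes a b c :: real
  shows "0 \<le> 3 * max a (max b c) - (a + b + c)"
    and "3 * max a (max b c) - (a + b + c) = 0 \<Longrightarrow> a = b \<and> a = c"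
  unfolding max_def by (auto split: if_splits)

lemma shape_defect_nonneg: "0 \<le> shape_defect glue x t"
  unfolding shape_defect_def Let_def by (rule max3_defect(1))

lemma continuous_shape_defect: "continuous_on S (\<lambda>x. shape_defect glue x t)"
  unfolding shape_defect_def Let_def by (intro continuous_intros)

lemma shape_defect_scale:
  assumes "c > 0"
  shows "shape_defect glue (c *\<^sub>R x) t = c * shape_defect glue x t"
proof -
  have max: "max (c * p) (c * q) = c * max p q" for p q :: real
    using assms by (simp add: max_mult_distrib_left)
  show ?thesis
    unfolding shape_defect_def Let_def vector_scaleR_component real_scaleR_def
    unfolding distrib_left[symmetric] max by (simp only: right_diff_distrib mult.left_commute)
qed

lemma shape_defect_zero: "shape_defect glue 0 t = 0"
  by (simp add: shape_defect_def Let_def)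

text \<open>If the three sums over opposite edges are equal, the coordinates of the edges are sums of weights
  of their end points. The weights then have total \<open>x $ cell_of glue t {0,1} + x $ cell_of glue t {2,3}\<close>,
  and the sum of the coordinates of the edges at \<open>i\<close> exceeds this total by twice the weight of
  \<open>i\<close>.\<close>

definition vertex_weight :: "'t::finite gluing \<Rightarrow> real ^ 't cell \<Rightarrow> 't \<Rightarrow> 4 \<Rightarrow> real" where
  "vertex_weight glue x t i = ((\<Sum>j\<in>UNIV - {i}. x $ cell_of glue t {i, j})
     - (x $ cell_of glue t {0,1} + x $ cell_of glue t {2,3})) / 2"

text \<open>The weight of a vertex is determined by any one of the three faces that contain it, and hence is
  compatible with the face pairing.\<close>

lemma vertex_weight_face:
  assumes "shape_defect glue x t = 0" and "i \<noteq> j" "i \<noteq> k" "j \<noteq> k"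
  shows "vertex_weight glue x t i =
    (x $ cell_of glue t {i, j} + x $ cell_of glue t {i, k} - x $ cell_of glue t {j, k}) / 2"
proof -
  let ?y = "\<lambda>i j. x $ cell_of glue t {i, j}"
  define p p' q q' r r' where pq: "p = ?y 0 1" "p' = ?y 2 3" "q = ?y 0 2" "q' = ?y 1 3"
    "r = ?y 1 2" "r' = ?y 0 3"
  have c: "{1,0} = {0,1::4}" "{2,0} = {0,2::4}" "{3,0} = {0,3::4}" "{2,1} = {1,2::4}"
    "{3,1} = {1,3::4}" "{3,2} = {2,3::4}"
    by auto
  have y: "?y 0 1 = p" "?y 2 3 = p'" "?y 0 2 = q" "?y 1 3 = q'" "?y 1 2 = r" "?y 0 3 = r'"
    "?y 1 0 = p" "?y 3 2 = p'" "?y 2 0 = q" "?y 3 1 = q'" "?y 2 1 = r" "?y 3 0 = r'"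
    unfolding pq c by (rule refl)+
  have "p + p' = q + q'" "p + p' = r + r'"
    using max3_defect(2)[OF assms(1)[unfolded shape_defect_def Let_def]] unfolding pq
      by (rule conjunct1, rule conjunct2)
  then have eq: "p' = q + q' - p" "r' = q + q' - r" by linarith+
  have "\<forall>i j k. i \<noteq> j \<and> i \<noteq> k \<and> j \<noteq> k \<longrightarrow> vertex_weight glue x t i = (?y i j + ?y i k - ?y j k) / 2"
    unfolding all_4_from_0 vertex_weight_def sum_remove_4 y eq by simp
  then show ?thesis using assms(2-4) by blast
qed

lemma vertex_weight_edge:
  assumes "shape_defect glue x t = 0" "i \<noteq> j"
  shows "x $ cell_of glue t {i, j} = vertex_weight glue x t i + vertex_weight glue x t j"
proof -
  have "\<forall>i j::4. \<exists>k. k \<noteq> i \<and> k \<noteq> j" unfolding all_4_from_0 ex_4_from_0 by simp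
  then obtain k where "k \<noteq> i" "k \<noteq> j" by blast
  then show ?thesis
    using vertex_weight_face[OF assms(1), of i j k] vertex_weight_face[OF assms(1), of j i k] assms(2)
    by (simp add: insert_commute field_simps)
qed

lemma vertex_weight_glue:
  assumes fp: "face_pairing glue" and zero: "\<And>t. shape_defect glue x t = 0"
    and glue: "glue t i = (t', \<pi>)" and ij: "i \<noteq> j"
  shows "vertex_weight glue x t' (\<pi> j) = vertex_weight glue x t j"
proof -
  have "\<forall>i j::4. i \<noteq> j \<longrightarrow> (\<exists>k l. k \<noteq> i \<and> k \<noteq> j \<and> l \<noteq> i \<and> l \<noteq> j \<and> k \<noteq> l)"
    unfolding all_4_from_0 ex_4_from_0 by simp
  then obtain k l where kl: "k \<noteq> i" "k \<noteq> j" "l \<noteq> i" "l \<noteq> j" "k \<noteq> l" using ij by blast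
  have inj: "inj \<pi>" by (rule face_pairing_inj[OF fp glue])
  have "cell_of glue t' {\<pi> p, \<pi> q} = cell_of glue t {p, q}" if "i \<noteq> p" "i \<noteq> q" for p q
    using cell_of_glue[of glue t i t' \<pi> "{p, q}"] glue that by simp
  then show ?thesis
    using vertex_weight_face[OF zero, of j k l t] vertex_weight_face[OF zero, of "\<pi> j" "\<pi> k"
      "\<pi> l" t'] kl ij
    by (simp add: inj_eq[OF inj])
qed

text \<open>Coordinates without shape defect lie in the orbit of \<open>0\<close>: the vertex weights descend
  to the boundary components.\<close>

lemma shape_defect_zero_imp_orbit:
  fixes glue :: "'t::finite gluing"
  assumes fp: "face_pairing glue" and zero: "\<And>t. shape_defect glue x t = 0"
    and x: "x \<in> coordinate_subspace (edges glue)"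
  shows "x \<in> incidence_map glue ` coordinate_subspace (boundary_components glue)"
proof -
  \<comment> \<open>The vertex weight as a function on cells; the value off the vertices is irrelevant.\<close>
  define F where "F = (\<lambda>c :: 't \<times> 4 set. if card (snd c)
      = 1 then vertex_weight glue x (fst c) (the_elem (snd c)) else 0)"
  have F: "F d = F c" if "(c, d) \<in> cell_equiv glue" for c d
  proof (rule cell_equiv_invariant[OF that])
    fix t s t' \<pi> i assume g: "glue t i = (t', \<pi>)" and i: "i \<notin> s"
    have card: "card (\<pi> ` s) = card s"
      by (simp add: card_image inj_on_subset[OF face_pairing_inj[OF fp g]])
    show "F (t', \<pi> ` s) = F (t, s)"
    proof (cases "card s = 1")
      case True
      then obtain k where "s = {k}" by (auto simp: card_1_singleton_iff)
      then show ?thesis using vertex_weight_glue[OF fp zero g, of k] i by (simp add: F_def)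
    qed (simp add: F_def card)
  qed
  define u where "u = (\<chi> v. if v \<in> boundary_components glue then F (SOME c. c \<in> v) else 0)"
  have u: "u $ cell_of glue t {i} = vertex_weight glue x t i" for t i
  proof -
    have "(SOME c. c \<in> cell_of glue t {i}) \<in> cell_of glue t {i}"
      by (rule someI[of "\<lambda>c. c \<in> cell_of glue t {i}", OF mem_cell_of])
    then have "F (SOME c. c \<in> cell_of glue t {i}) = F (t, {i})"
      by (intro F) (simp add: cell_of_def)
    then show ?thesis by (simp add: u_def cell_of_in_boundary F_def)
  qed
  have "incidence_map glue u = x"
  proof (rule vec_eq_iff[THEN iffD2], rule allI)
    fix e
    show "incidence_map glue u $ e = x $ e"
    proof (cases "e \<in> edges glue")
      case True
      obtain t i j where c: "(t, {i, j}) \<in> e" "i \<noteq> j" "e = cell_of glue t {i, j}"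
        using edge_nonempty[OF fp True] by metis
      have "incidence_map glue u $ e =
          (\<Sum>v\<in>boundary_components glue. real (card {k \<in> {i, j}. cell_of glue t {k} = v}) * u $ v)"
        using True by (simp add: incidence_map_def edge_ends_eq[OF fp True c(1)] corner_ends_def)
      also have "\<dots> = (\<Sum>v\<in>boundary_components glue. \<Sum>k | k \<in> {i, j}
          \<and> cell_of glue t {k} = v. u $ cell_of glue t {k})"
        by (intro sum.cong) auto
      also have "\<dots> = (\<Sum>k\<in>{i, j}. u $ cell_of glue t {k})"
        by (rule sum.group) (auto intro: cell_of_in_boundary)
      also have "\<dots> = x $ e"
        using c vertex_weight_edge[OF zero c(2), of t] by (simp add: u)
      finally show ?thesis .
    next
      case False
      then show ?thesis using x by (simp add: incidence_map_def coordinate_subspace_def)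
    qed
  qed
  moreover have "u \<in> coordinate_subspace (boundary_components glue)"
    by (simp add: u_def coordinate_subspace_def)
  ultimately show ?thesis by blast
qed

lemma subspace_orbit_slice: "subspace (orbit_slice glue)"
  unfolding orbit_slice_def
  by (intro subspace_inter subspace_orthogonal_comp)
     (auto simp: coordinate_subspace_def subspace_def)

lemma sum_shape_defect_pos:
  assumes fp: "face_pairing glue" and x: "x \<in> orbit_slice glue" "x \<noteq> 0"
  shows "(\<Sum>t\<in>UNIV. shape_defect glue x t) > 0"
proof (rule ccontr)
  assume "\<not> ?thesis"
  moreover have "(\<Sum>t\<in>UNIV. shape_defect glue x t) \<ge> 0"
    by (rule sum_nonneg) (rule shape_defect_nonneg)
  ultimately have "(\<Sum>t\<in>UNIV. shape_defect glue x t) = 0" by linarith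
  then have "shape_defect glue x t = 0" for t
    by (simp add: sum_nonneg_eq_0_iff shape_defect_nonneg)
  then have "x \<in> incidence_map glue ` coordinate_subspace (boundary_components glue)"
    using shape_defect_zero_imp_orbit[OF fp] x unfolding orbit_slice_def by blast
  then have "orthogonal x x"
    using x(1) unfolding orbit_slice_def orthogonal_comp_def by blast
  then show False using x(2) by (simp add: orthogonal_def)
qed

text \<open>As the angles around each edge add up to \<open>2 * pi\<close>, the sum over the edges distributes over the
  corners, and so over the tetrahedra.\<close>

lemma sum_edges_eq_sum_angles:
  assumes fp: "face_pairing glue" and \<theta>: "angle_structure glue \<theta>"
  shows "2 * pi * (\<Sum>e\<in>edges glue. x $ e) =
    (\<Sum>t\<in>UNIV. \<theta> (t, {0,1}) * (x $ cell_of glue t {0,1} + x $ cell_of glue t {2,3})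
      + \<theta> (t, {0,2}) * (x $ cell_of glue t {0,2} + x $ cell_of glue t {1,3})
      + \<theta> (t, {1,2}) * (x $ cell_of glue t {1,2} + x $ cell_of glue t {0,3}))"
proof -
  have "2 * pi * (\<Sum>e\<in>edges glue. x $ e) = (\<Sum>e\<in>edges glue. (\<Sum>c\<in>e. \<theta> c) * x $ e)"
    unfolding sum_distrib_left using \<theta> by (intro sum.cong) (auto simp: angle_structure_def)
  also have "\<dots> = (\<Sum>e\<in>edges glue. \<Sum>c\<in>e. \<theta> c * x $ cell_of glue (fst c) (snd c))"
    unfolding sum_distrib_right
  proof (intro sum.cong refl)
    fix e c assume e: "e \<in> edges glue" and c: "c \<in> e"
    then have "e = cell_of glue (fst c) (snd c)" using edge_eq_cell_of[OF e, of "fst c" "snd c"]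
      by simp
    then show "\<theta> c * x $ e = \<theta> c * x $ cell_of glue (fst c) (snd c)" by (simp only:)
  qed
  also have "\<dots> = (\<Sum>t\<in>UNIV. \<Sum>s | card s = 2. \<theta> (t, s) * x $ cell_of glue t s)"
    by (subst sum_edges_corners[OF fp]) simp
  also have "\<dots> = (\<Sum>t\<in>UNIV. \<theta> (t, {0,1}) * (x $ cell_of glue t {0,1} + x $ cell_of glue t {2,3})
      + \<theta> (t, {0,2}) * (x $ cell_of glue t {0,2} + x $ cell_of glue t {1,3})
      + \<theta> (t, {1,2}) * (x $ cell_of glue t {1,2} + x $ cell_of glue t {0,3}))"
    unfolding sum_pairs_4 angle_structure_opposite[OF \<theta>] by (simp add: algebra_simps)
  finally show ?thesis .
qed

section \<open>Lebesgue measure on a subspace\<close>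

lemma integrable_scale_measure:
  fixes f :: "'a \<Rightarrow> 'b :: {banach, second_countable_topology}"
  assumes f: "integrable M f" and r: "r < \<infinity>"
  shows "integrable (scale_measure r M) f"
proof -
  have [measurable]: "f \<in> borel_measurable M" using f by simp
  have "(\<integral>\<^sup>+x. ennreal (norm (f x)) \<partial>scale_measure r M) = r * (\<integral>\<^sup>+x. ennreal (norm (f x)) \<partial>M)"
    by (rule nn_integral_scale_measure) simp
  also have "\<dots> < \<infinity>" using f r by (simp add: integrable_iff_bounded ennreal_mult_less_top)
  finally show ?thesis by (simp add: integrable_iff_bounded)
qed

lemma subspace_lborel_space_sets:
  "space (subspace_lborel X) = X" "sets (subspace_lborel X) = sets (restrict_space borel X)"
  by (simp_all add: subspace_lborel_def Let_def space_restrict_space)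

lemma integrable_exp_norm_subspace_lborel:
  fixes X :: "'a::euclidean_space set"
  assumes X: "subspace X" and k: "k > 0"
  shows "integrable (subspace_lborel X) (\<lambda>x. exp (- k * norm x))"
proof -
  have "\<exists>B. orthonormal_basis_of X B"
    using orthonormal_basis_subspace[OF X] unfolding orthonormal_basis_of_def by metis
  define B where "B = (SOME B. orthonormal_basis_of X B)"
  have B: "orthonormal_basis_of X B"
    unfolding B_def by (rule someI_ex) fact
  have BX: "B \<subseteq> X" and orth: "\<And>x y. x \<in> B \<Longrightarrow> y \<in> B \<Longrightarrow> x \<noteq> y \<Longrightarrow> x \<bullet> y = 0"
    and norm: "\<And>x. x \<in> B \<Longrightarrow> norm x = 1"
    using B by (auto simp: orthonormal_basis_of_def pairwise_def orthogonal_def)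
  have "0 \<notin> B" using norm by force
  then have "independent B"
    using B pairwise_orthogonal_independent unfolding orthonormal_basis_of_def by blast
  then have fin: "finite B" using independent_imp_finite by blast
  let ?P = "\<Pi>\<^sub>M b\<in>B. (lborel :: real measure)"
  let ?e = "\<lambda>f. \<Sum>b\<in>B. f b *\<^sub>R b"
  have e: "?e \<in> measurable ?P (restrict_space borel X)"
  proof (rule measurable_restrict_space2)
    show "?e \<in> space ?P \<rightarrow> X"
      using BX by (auto intro!: subspace_sum[OF X] subspace_scale[OF X])
    show "?e \<in> borel_measurable ?P" by measurable
  qed
  have coord: "?e f \<bullet> b = f b" if "b \<in> B" for f b
  proof -
    have "?e f \<bullet> b = (\<Sum>b'\<in>B. if b' = b then f b else 0)"
      unfolding inner_sum_left using orth norm that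
      by (intro sum.cong) (auto simp: dot_square_norm)
    then show ?thesis using fin that by simp
  qed
  \<comment> \<open>\<open>+ 1\<close> because \<open>B\<close> is empty when \<open>X\<close> is trivial\<close>
  define l where "l = k / (real (card B) + 1)"
  have l: "l > 0" using k by (simp add: l_def)
  have "integrable ?P (\<lambda>f. exp (- k * norm (?e f)))"
  proof (rule Bochner_Integration.integrable_bound)
    interpret product_sigma_finite "\<lambda>_. lborel :: real measure"
      by (rule product_sigma_finite.intro) (rule lborel.sigma_finite_measure_axioms)
    show "integrable ?P (\<lambda>f. \<Prod>b\<in>B. exp (- l * \<bar>f b\<bar>))"
      by (rule product_integrable_prod[OF fin]) (rule integrable_exp_abs[OF l])
    show "(\<lambda>f. exp (- k * norm (?e f))) \<in> borel_measurable ?P" by measurable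
    show "AE f in ?P. norm (exp (- k * norm (?e f))) \<le> norm (\<Prod>b\<in>B. exp (- l * \<bar>f b\<bar>))"
    proof (rule AE_I2)
      fix f
      have "(\<Sum>b\<in>B. \<bar>f b\<bar>) \<le> (\<Sum>b\<in>B. norm (?e f))"
      proof (rule sum_mono)
        fix b assume b: "b \<in> B"
        show "\<bar>f b\<bar> \<le> norm (?e f)"
          using Cauchy_Schwarz_ineq2[of "?e f" b]
            by (simp only: coord[OF b] norm[OF b] mult_1_right)
      qed
      also have "\<dots> \<le> (real (card B) + 1) * norm (?e f)" by (simp add: distrib_right)
      finally have "l * (\<Sum>b\<in>B. \<bar>f b\<bar>) \<le> l * ((real (card B) + 1) * norm (?e f))"
        using l by simp
      also have "\<dots> = k * norm (?e f)" by (simp add: l_def)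
      finally show "norm (exp (- k * norm (?e f))) \<le> norm (\<Prod>b\<in>B. exp (- l * \<bar>f b\<bar>))"
        using fin by (simp add: exp_sum[symmetric] sum_distrib_left sum_negf abs_prod)
    qed
  qed
  then show ?thesis
    unfolding subspace_lborel_def Let_def B_def[symmetric]
    by (subst integrable_distr_eq[OF e]) (auto intro!: measurable_restrict_space1)
qed

text \<open>Compactness of the unit sphere of \<open>X\<close>.\<close>

lemma positively_homogeneous_lower_bound:
  fixes f :: "'a::euclidean_space \<Rightarrow> real"
  assumes X: "subspace X" and cont: "continuous_on UNIV f"
    and hom: "\<And>c x. c > 0 \<Longrightarrow> f (c *\<^sub>R x) = c * f x"
    and pos: "\<And>x. x \<in> X \<Longrightarrow> x \<noteq> 0 \<Longrightarrow> f x > 0" and zero: "f 0 = 0"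
  obtains k where "k > 0" "\<And>x. x \<in> X \<Longrightarrow> k * norm x \<le> f x"
proof (cases "X \<inter> sphere 0 1 = {}")
  case True
  have "x = 0" if "x \<in> X" for x
  proof (rule ccontr)
    assume "x \<noteq> 0"
    then have "(1 / norm x) *\<^sub>R x \<in> X \<inter> sphere 0 1" using subspace_scale[OF X that] by simp
    then show False using True by blast
  qed
  then show ?thesis using that[of 1] zero by force
next
  case False
  have "compact (X \<inter> sphere 0 1)"
    by (rule closed_Int_compact) (auto simp: closed_subspace[OF X])
  then obtain z where z: "z \<in> X \<inter> sphere 0 1" "\<And>x. x \<in> X \<inter> sphere 0 1 \<Longrightarrow> f z \<le> f x"
    using continuous_attains_inf[OF _ False continuous_on_subset[OF cont]] by blast
  show ?thesis
  proof (rule that)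
    have "z \<noteq> 0" using z(1) by auto
    then show "f z > 0" using z(1) pos[of z] by simp
    fix x assume x: "x \<in> X"
    show "f z * norm x \<le> f x"
    proof (cases "x = 0")
      case False
      have "(1 / norm x) *\<^sub>R x \<in> X \<inter> sphere 0 1" using False subspace_scale[OF X x] by simp
      from z(2)[OF this] have "f z \<le> (1 / norm x) * f x" using hom[of "1 / norm x" x] False by simp
      then show ?thesis using False by (simp add: field_simps)
    qed (simp add: zero)
  qed
qed

section \<open>Absolute convergence of the state integral\<close>

lemma edge_weight_eq: "edge_weight b (Complex (Q b / 2) y) = exp (2 * pi * Q b * y)"
  by (simp add: edge_weight_def norm_T_fun power2_eq_square flip: exp_add)

text \<open>The exponent of a single tetrahedron. Because the angles add up to \<open>pi\<close>, the left-hand side is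
  invariant under adding a constant to all \<open>s_j\<close>, and equals the sum of the terms
  \<open>- (q * A_j - 2 * pi * d) * (m - s_j)\<close>.\<close>

lemma angle_weighted_estimate:
  fixes q d k A1 A2 A3 s1 s2 s3 :: real
  assumes A: "A1 + A2 + A3 = pi" and k: "k \<le> q * A1 - 2 * pi * d" "k \<le> q * A2 - 2 * pi * d"
    "k \<le> q * A3 - 2 * pi * d"
  defines "m \<equiv> max s1 (max s2 s3)"
  shows "q * (A1 * s1 + A2 * s2 + A3 * s3) + pi * (- 2 * d * (s1 + s2 + s3) + (6 * d - q) * m)
    \<le> - k * (3 * m - (s1 + s2 + s3))"
proof -
  have m: "0 \<le> m - s1" "0 \<le> m - s2" "0 \<le> m - s3" by (auto simp: m_def)
  have A3: "A3 = pi - A1 - A2" using A by simp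
  have "q * (A1 * s1 + A2 * s2 + A3 * s3) + pi * (- 2 * d * (s1 + s2 + s3) + (6 * d - q) * m)
    = - ((q * A1 - 2 * pi * d) * (m - s1) + (q * A2 - 2 * pi * d) * (m - s2)
        + (q * A3 - 2 * pi * d) * (m - s3))"
    unfolding A3 by (simp add: algebra_simps)
  also have "\<dots> \<le> - (k * (m - s1) + k * (m - s2) + k * (m - s3))"
    unfolding neg_le_iff_le by (intro add_mono mult_right_mono k m)
  also have "\<dots> = - k * (3 * m - (s1 + s2 + s3))" by (simp add: algebra_simps)
  finally show ?thesis .
qed

lemma angle_structure_lower_bound:
  fixes glue :: "'t::finite gluing"
  assumes "angle_structure glue \<theta>"
  obtains \<alpha> where "\<alpha> > 0" "\<And>t s. card s = 2 \<Longrightarrow> \<alpha> \<le> \<theta> (t, s)"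
proof
  have fin: "finite (\<theta> ` corners)" by simp
  have "(undefined, {0, 1}) \<in> corners" by (simp add: corners_def)
  then have ne: "\<theta> ` corners \<noteq> {}" by blast
  show "Min (\<theta> ` corners) > 0"
    using Min_in[OF fin ne] assms unfolding angle_structure_def by auto
  show "Min (\<theta> ` corners) \<le> \<theta> (t, s)" if "card s = 2" for t s
    by (rule Min_le[OF fin]) (use that in \<open>auto simp: corners_def\<close>)
qed

lemma state_integrand_bound:
  fixes glue :: "'t::finite gluing"
  assumes fp: "face_pairing glue" and \<theta>: "angle_structure glue \<theta>"
    and b: "0 < b" "b < 1" and c: "11 * Q b / 6 < c" "c < 2 * Q b"
  obtains K k where "k > 0"
    "\<And>x. cmod (state_integrand b c glue x) \<le> K * exp (- k * (\<Sum>t\<in>UNIV. shape_defect glue x t))"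
proof -
  have Q: "Q b > 0" by (rule Q_pos[OF b(1)])
  obtain \<alpha> where \<alpha>: "\<alpha> > 0" "\<And>t s. card s = 2 \<Longrightarrow> \<alpha> \<le> \<theta> (t, s)"
    using angle_structure_lower_bound[OF \<theta>] by metis
  \<comment> \<open>The first bound makes the contour admissible, the second one leaves at least half of each \<open>Q b * \<theta> c\<close>.\<close>
  define d where "d = min (Q b / 12) (Q b * \<alpha> / (4 * pi))"
  have d: "0 < d" "6 * d < Q b" using Q \<alpha> by (auto simp: d_def)
  have "2 * pi * d \<le> 2 * pi * (Q b * \<alpha> / (4 * pi))" by (rule mult_left_mono) (auto simp: d_def)
  then have d\<alpha>: "2 * pi * d \<le> Q b * \<alpha> / 2" by (simp add: mult.commute)
  define k where "k = Q b * \<alpha> / 2"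
  obtain C where C: "C > 0" and bound:
    "\<And>y1 y2 y3 y4 y5 y6 S m. S = (y1 + y4) + (y2 + y5) + (y3 + y6) \<Longrightarrow>
       m = max (y1 + y4) (max (y2 + y5) (y3 + y6)) \<Longrightarrow>
       cmod (ideal_6j b (2 * Q b - d) (Complex (Q b / 2) y1) (Complex (Q b / 2) y2)
           (Complex (Q b / 2) y3)
         (Complex (Q b / 2) y4) (Complex (Q b / 2) y5) (Complex (Q b / 2) y6))
       \<le> C * exp (pi * (- 2 * d * S + (6 * d - Q b) * m))"
    using ideal_6j_bound[OF b d] by blast
  show ?thesis
  proof (rule that)
    show "k > 0" using Q \<alpha> by (simp add: k_def)
    fix x :: "real ^ 't cell"
    let ?s1 = "\<lambda>t. x $ cell_of glue t {0,1} + x $ cell_of glue t {2,3}"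
    let ?s2 = "\<lambda>t. x $ cell_of glue t {0,2} + x $ cell_of glue t {1,3}"
    let ?s3 = "\<lambda>t. x $ cell_of glue t {1,2} + x $ cell_of glue t {0,3}"
    let ?E = "\<lambda>t. pi * (- 2 * d * (?s1 t + ?s2 t + ?s3 t)
        + (6 * d - Q b) * max (?s1 t) (max (?s2 t) (?s3 t)))"
    let ?A = "\<lambda>t. \<theta> (t, {0,1}) * ?s1 t + \<theta> (t, {0,2}) * ?s2 t + \<theta> (t, {1,2}) * ?s3 t"
    let ?a = "\<lambda>e. Complex (Q b / 2) (x $ e)"
    have tet: "cmod (tetrahedron_weight b c glue ?a t) \<le> C * exp (?E t)" for t
    proof -
      have "tetrahedron_weight b c glue ?a t = tetrahedron_weight b (2 * Q b - d) glue ?a t"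
        unfolding tetrahedron_weight_def Let_def
        by (rule ideal_6j_contour_independent[OF b c]) (use d in auto)
      then show ?thesis
        unfolding tetrahedron_weight_def Let_def using bound[OF refl refl] by simp
    qed
    have "cmod (\<Prod>e\<in>edges glue. complex_of_real (edge_weight b (?a e)))
        = exp (Q b * (2 * pi * (\<Sum>e\<in>edges glue. x $ e)))"
      by (simp add: prod_norm[symmetric] edge_weight_eq exp_sum[symmetric] sum_distrib_left mult_ac)
    also have "\<dots> = exp (\<Sum>t\<in>UNIV. Q b * ?A t)"
      unfolding sum_edges_eq_sum_angles[OF fp \<theta>]
        by (rule arg_cong[of _ _ exp], rule sum_distrib_left)
    finally have edge: "cmod (\<Prod>e\<in>edges glue. complex_of_real (edge_weight b (?a e)))
        = exp (\<Sum>t\<in>UNIV. Q b * ?A t)" .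
    have "cmod (\<Prod>t\<in>UNIV. tetrahedron_weight b c glue ?a t) \<le> (\<Prod>t\<in>(UNIV::'t set). C * exp (?E t))"
      unfolding prod_norm[symmetric] by (rule prod_mono) (use tet in auto)
    also have "\<dots> = C ^ CARD('t) * exp (\<Sum>t\<in>UNIV. ?E t)"
      by (simp add: prod.distrib exp_sum)
    finally have "cmod (state_integrand b c glue x)
        \<le> exp (\<Sum>t\<in>UNIV. Q b * ?A t) * (C ^ CARD('t) * exp (\<Sum>t\<in>UNIV. ?E t))"
      unfolding state_integrand_def Let_def norm_mult edge by (rule mult_left_mono) simp
    also have "\<dots> = C ^ CARD('t) * exp (\<Sum>t\<in>UNIV. Q b * ?A t + ?E t)"
      by (simp add: sum.distrib exp_add)
    also have "\<dots> \<le> C ^ CARD('t) * exp (\<Sum>t\<in>UNIV. - k * shape_defect glue x t)"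
    proof (intro mult_left_mono iffD2[OF exp_le_cancel_iff] sum_mono)
      fix t
      have "k \<le> Q b * \<theta> (t, s) - 2 * pi * d" if "card s = 2" for s
      proof -
        have "Q b * \<alpha> \<le> Q b * \<theta> (t, s)" using \<alpha>(2)[OF that] Q by (intro mult_left_mono) auto
        then show ?thesis using d\<alpha> unfolding k_def by linarith
      qed
      then show "Q b * ?A t + ?E t \<le> - k * shape_defect glue x t"
        unfolding shape_defect_def Let_def
        by (intro angle_weighted_estimate angle_structure_opposite(4)[OF \<theta>]) simp_all
    qed (use C in simp)
    also have "(\<Sum>t\<in>UNIV. - k * shape_defect glue x t) = - k * (\<Sum>t\<in>UNIV. shape_defect glue x t)"
      by (rule sum_distrib_left[symmetric])
    finally show "cmod (state_integrand b c glue x)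
        \<le> C ^ CARD('t) * exp (- k * (\<Sum>t\<in>UNIV. shape_defect glue x t))" .
  qed
qed

lemma state_integrand_measurable:
  assumes "0 < b" "b < 1" "Q b < c" "c < 2 * Q b"
  shows "state_integrand b c glue \<in> borel_measurable borel"
proof -
  have "(\<lambda>x. tetrahedron_weight b c glue (\<lambda>e. Complex (Q b / 2) (x $ e)) t)
      \<in> borel_measurable borel" for t
    unfolding tetrahedron_weight_def Let_def by (intro ideal_6j_measurable assms) measurable
  then show ?thesis
    unfolding state_integrand_def Let_def edge_weight_eq by measurable
qed

theorem theorem1p4:
  fixes M :: "'m metric" and glue :: "'t::finite gluing" and b c :: real
  assumes "hyperbolic_3_manifold_with_cusp_ends M"
    and "ideal_triangulation glue M"
    and "\<exists>\<theta>. angle_structure glue \<theta>"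
    and "0 < b" and "b < 1"
    and "11 * Q b / 6 < c" and "c < 2 * Q b"
  shows "integrable (orbit_measure b glue) (state_integrand b c glue)"
proof -
  obtain \<theta> where \<theta>: "angle_structure glue \<theta>" using assms(3) by blast
  have fp: "face_pairing glue" using assms(2) by (simp add: ideal_triangulation_def)
  let ?X = "orbit_slice glue"
  obtain K k where k: "k > 0" and
    bound: "\<And>x. cmod (state_integrand b c glue x)
        \<le> K * exp (- k * (\<Sum>t\<in>UNIV. shape_defect glue x t))"
    using state_integrand_bound[OF fp \<theta> assms(4-7)] by metis
  obtain l where l: "l > 0" "\<And>x. x \<in> ?X \<Longrightarrow> l * norm x \<le> (\<Sum>t\<in>UNIV. shape_defect glue x t)"
  proof (rule positively_homogeneous_lower_bound[OF subspace_orbit_slice[of glue]])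
    show "continuous_on UNIV (\<lambda>x. \<Sum>t\<in>UNIV. shape_defect glue x t)"
      by (intro continuous_on_sum continuous_shape_defect)
    show "(\<Sum>t\<in>UNIV. shape_defect glue (r *\<^sub>R x) t) = r * (\<Sum>t\<in>UNIV. shape_defect glue x t)"
      if "r > 0" for r x
      by (simp add: shape_defect_scale[OF that] sum_distrib_left)
  qed (auto simp: shape_defect_zero sum_shape_defect_pos[OF fp])
  have K: "K \<ge> 0"
  proof -
    have "0 \<le> K * exp (- k * (\<Sum>t\<in>UNIV. shape_defect glue 0 t))"
      using order_trans[OF norm_ge_zero bound[of 0]] .
    then show ?thesis by (simp add: zero_le_mult_iff)
  qed
  have "integrable (subspace_lborel ?X) (state_integrand b c glue)"
  proof (rule Bochner_Integration.integrable_bound)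
    show "integrable (subspace_lborel ?X) (\<lambda>x. K * exp (- (k * l) * norm x))"
      using k l by (intro integrable_mult_right integrable_exp_norm_subspace_lborel subspace_orbit_slice) simp
    have "Q b < c" using assms(6) Q_pos[OF assms(4)] by linarith
    then have "state_integrand b c glue \<in> borel_measurable borel"
      by (intro state_integrand_measurable assms)
    then have "state_integrand b c glue \<in> borel_measurable (restrict_space borel ?X)"
      by (rule measurable_restrict_space1)
    then show "state_integrand b c glue \<in> borel_measurable (subspace_lborel ?X)"
      by (simp cong: measurable_cong_sets add: measurable_cong_sets[OF subspace_lborel_space_sets(2) refl])
    show "AE x in subspace_lborel ?X. cmod (state_integrand b c glue x)
        \<le> norm (K * exp (- (k * l) * norm x))"
    proof (rule AE_I2)
      fix x assume "x \<in> space (subspace_lborel ?X)"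
      then have "x \<in> ?X" by (simp add: subspace_lborel_space_sets)
      then have "k * (l * norm x) \<le> k * (\<Sum>t\<in>UNIV. shape_defect glue x t)"
        using k l(2) by (intro mult_left_mono) auto
      then have "K * exp (- k * (\<Sum>t\<in>UNIV. shape_defect glue x t)) \<le> K * exp (- (k * l) * norm x)"
        using K by (intro mult_left_mono) (auto simp: mult.assoc)
      also have "\<dots> \<le> norm (K * exp (- (k * l) * norm x))" by simp
      finally show "cmod (state_integrand b c glue x) \<le> norm (K * exp (- (k * l) * norm x))"
        using bound[of x] by linarith
    qed
  qed
  then show ?thesis
    unfolding orbit_measure_def by (rule integrable_scale_measure) simp
qed

end
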